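(* Let $A$ be an $R$-algebra over a commutative ring $R$ with $1_R\ne 0_R$, and let $\mathcal{C}$ be a non-zero $A$-coring such that ${}_A\mathcal{C}$ and $\mathcal{C}_A$ are flat. Then: 1. $\mathbf{Z}_{\mathcal{C}}:=(\mathrm{CPSpec}(\mathcal{C}),\tau_{\mathcal{C}})$ is a topological space. 2. $\mathbf{Z}_{\mathcal{C}^r}^{f.i.}:=(\mathrm{CPSpec}(\mathcal{C}^r),\tau_{\mathcal{C}^r}^{f.i.})$ and $\mathbf{Z}_{\mathcal{C}^l}^{f.i.}:=(\mathrm{CPSpec}(\mathcal{C}^l),\tau_{\mathcal{C}^l}^{f.i.})$ are topological spaces.
   Context: The coring $\mathcal{C}$ is regarded, via its comultiplication, as a $(\mathcal{C},\mathcal{C})$-bicomodule $\mathcal{C}$, as a right $\mathcal{C}$-comodule $\mathcal{C}^r$, and as a left $\mathcal{C}$-comodule $\mathcal{C}^l$. A right (left) $\mathcal{C}$-coideal is a right (left) $\mathcal{C}$-subcomodule of $\mathcal{C}$; a $\mathcal{C}$-bicoideal is a $(\mathcal{C},\mathcal{C})$-subbicomodule of $\mathcal{C}$. $\mathcal{B}(\mathcal{C})$ is the set of $\mathcal{C}$-bicoideals, and for $K\in\mathcal{B}(\mathcal{C})$, $K^r$ ($K^l$) denotes $K$ regarded as a right (left) $\mathcal{C}$-comodule. Let $M$ be an object of one of the categories of $(\mathcal{C},\mathcal{C})$-bicomodules, right $\mathcal{C}$-comodules, or left $\mathcal{C}$-comodules, and let $E$ be the opposite of its endomorphism ring in that category.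 A subobject $L\subseteq M$ is fully invariant iff $f(L)\subseteq L$ for all $f\in E$. For $X\subseteq M$ let $\mathrm{An}(X)=\{f\in E\mid f(X)=0\}$ and for $X,Y\subseteq M$ let $(X:_M Y):=\bigcap_{f\in\mathrm{An}(X)}f^{-1}(Y)$. A non-zero fully invariant subobject $K\subseteq M$ is fully $M$-coprime iff for all fully invariant subobjects $X,Y\subseteq M$ with $K\subseteq (X:_MY)$ one has $K\subseteq X$ or $K\subseteq Y$. Set $\mathrm{CPSpec}(\mathcal{C}):=\{K\in\mathcal{B}(\mathcal{C})\mid K\text{ is fully }\mathcal{C}\text{-coprime}\}$ (in the category of bicomodules), $\mathrm{CPSpec}(\mathcal{C}^r):=\{K\in\mathcal{B}(\mathcal{C})\mid K^r\text{ is fully }\mathcal{C}^r\text{-coprime}\}$, $\mathrm{CPSpec}(\mathcal{C}^l):=\{K\in\mathcal{B}(\mathcal{C})\mid K^l\text{ is fully }\mathcal{C}^l\text{-coprime}\}$. In each case, $\mathcal{X}_L$ denotes the set of those $K$ in the respective spectrum with $K\nsubseteq L$. Finally, $\tau_{\mathcal{C}}:=\{\mathcal{X}_L\mid L\in\mathcal{B}(\mathcal{C})\}$, and $\tau^{f.i.}_{\mathcal{C}^r}$ (resp. $\tau^{f.i.}_{\mathcal{C}^l}$) is the set of all $\mathcal{X}_L$ with $L$ a fully invariant right (resp. left) $\mathcal{C}$-subcomodule of $\mathcal{C}^r$ (resp. $\mathcal{C}^l$). *)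

theory Defs
  imports "HOL-Algebra.Free_Abelian_Groups" "HOL-Algebra.Module"
    "HOL-Analysis.Abstract_Topology"
begin

section \<open>Algebras and modules over a not necessarily commutative ring\<close>

text \<open>HOL-Algebra's \<open>algebra\<close> is commutative, hence this locale.\<close>

locale assoc_algebra = Module.module R A + ring A for R (structure) and A (structure) +
  assumes smult_mult_left:
      "\<lbrakk>r \<in> carrier R; x \<in> carrier A; y \<in> carrier A\<rbrakk>
        \<Longrightarrow> (r \<odot>\<^bsub>A\<^esub> x) \<otimes>\<^bsub>A\<^esub> y = r \<odot>\<^bsub>A\<^esub> (x \<otimes>\<^bsub>A\<^esub> y)"
    and smult_mult_right:
      "\<lbrakk>r \<in> carrier R; x \<in> carrier A; y \<in> carrier A\<rbrakk>
        \<Longrightarrow> x \<otimes>\<^bsub>A\<^esub> (r \<odot>\<^bsub>A\<^esub> y) = r \<odot>\<^bsub>A\<^esub> (x \<otimes>\<^bsub>A\<^esub> y)"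

text \<open>
  One record type serves for left modules, right modules and bimodules; the one-sided notions
  ignore the other action.  As in the library's record \<open>module\<close>, the fields
  \<open>mult\<close> and \<open>one\<close> inherited from \<open>ring\<close> carry no meaning.
\<close>

record ('a, 'm) bimod = "'m ring" +
  lact :: "['a, 'm] \<Rightarrow> 'm" (infixl \<open>\<triangleright>\<index>\<close> 70)
  ract :: "['m, 'a] \<Rightarrow> 'm" (infixl \<open>\<triangleleft>\<index>\<close> 70)

locale left_module = ring A + abelian_group M for A (structure) and M (structure) +
  assumes lact_closed: "\<lbrakk>a \<in> carrier A; x \<in> carrier M\<rbrakk> \<Longrightarrow> a \<triangleright>\<^bsub>M\<^esub> x \<in> carrier M"
    and lact_distr_scalar: "\<lbrakk>a \<in> carrier A; b \<in> carrier A; x \<in> carrier M\<rbrakk>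
        \<Longrightarrow> (a \<oplus>\<^bsub>A\<^esub> b) \<triangleright>\<^bsub>M\<^esub> x = a \<triangleright>\<^bsub>M\<^esub> x \<oplus>\<^bsub>M\<^esub> b \<triangleright>\<^bsub>M\<^esub> x"
    and lact_distr: "\<lbrakk>a \<in> carrier A; x \<in> carrier M; y \<in> carrier M\<rbrakk>
        \<Longrightarrow> a \<triangleright>\<^bsub>M\<^esub> (x \<oplus>\<^bsub>M\<^esub> y) = a \<triangleright>\<^bsub>M\<^esub> x \<oplus>\<^bsub>M\<^esub> a \<triangleright>\<^bsub>M\<^esub> y"
    and lact_assoc: "\<lbrakk>a \<in> carrier A; b \<in> carrier A; x \<in> carrier M\<rbrakk>
        \<Longrightarrow> (a \<otimes>\<^bsub>A\<^esub> b) \<triangleright>\<^bsub>M\<^esub> x = a \<triangleright>\<^bsub>M\<^esub> (b \<triangleright>\<^bsub>M\<^esub> x)"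
    and lact_one: "x \<in> carrier M \<Longrightarrow> \<one>\<^bsub>A\<^esub> \<triangleright>\<^bsub>M\<^esub> x = x"

locale right_module = ring A + abelian_group M for A (structure) and M (structure) +
  assumes ract_closed: "\<lbrakk>a \<in> carrier A; x \<in> carrier M\<rbrakk> \<Longrightarrow> x \<triangleleft>\<^bsub>M\<^esub> a \<in> carrier M"
    and ract_distr_scalar: "\<lbrakk>a \<in> carrier A; b \<in> carrier A; x \<in> carrier M\<rbrakk>
        \<Longrightarrow> x \<triangleleft>\<^bsub>M\<^esub> (a \<oplus>\<^bsub>A\<^esub> b) = x \<triangleleft>\<^bsub>M\<^esub> a \<oplus>\<^bsub>M\<^esub> x \<triangleleft>\<^bsub>M\<^esub> b"
    and ract_distr: "\<lbrakk>a \<in> carrier A; x \<in> carrier M; y \<in> carrier M\<rbrakk>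
        \<Longrightarrow> (x \<oplus>\<^bsub>M\<^esub> y) \<triangleleft>\<^bsub>M\<^esub> a = x \<triangleleft>\<^bsub>M\<^esub> a \<oplus>\<^bsub>M\<^esub> y \<triangleleft>\<^bsub>M\<^esub> a"
    and ract_assoc: "\<lbrakk>a \<in> carrier A; b \<in> carrier A; x \<in> carrier M\<rbrakk>
        \<Longrightarrow> x \<triangleleft>\<^bsub>M\<^esub> (a \<otimes>\<^bsub>A\<^esub> b) = (x \<triangleleft>\<^bsub>M\<^esub> a) \<triangleleft>\<^bsub>M\<^esub> b"
    and ract_one: "x \<in> carrier M \<Longrightarrow> x \<triangleleft>\<^bsub>M\<^esub> \<one>\<^bsub>A\<^esub> = x"

text \<open>
  Bimodules over an \<open>R\<close>-algebra have the same \<open>R\<close>-module structure from both sides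
  (assumption \<open>central\<close>).  For \<open>R = \<int>\<close> this is automatic.
\<close>

locale bimodule = assoc_algebra R A + left_module A M + right_module A M
  for R (structure) and A (structure) and M (structure) +
  assumes act_commute: "\<lbrakk>a \<in> carrier A; b \<in> carrier A; x \<in> carrier M\<rbrakk>
        \<Longrightarrow> (a \<triangleright>\<^bsub>M\<^esub> x) \<triangleleft>\<^bsub>M\<^esub> b = a \<triangleright>\<^bsub>M\<^esub> (x \<triangleleft>\<^bsub>M\<^esub> b)"
    and central: "\<lbrakk>r \<in> carrier R; x \<in> carrier M\<rbrakk>
        \<Longrightarrow> (r \<odot>\<^bsub>A\<^esub> \<one>\<^bsub>A\<^esub>) \<triangleright>\<^bsub>M\<^esub> x = x \<triangleleft>\<^bsub>M\<^esub> (r \<odot>\<^bsub>A\<^esub> \<one>\<^bsub>A\<^esub>)"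

text \<open>As usual in HOL-Algebra, only the values of a map on the carrier matter.\<close>

definition additive_map ::
  "('m, 'x) ring_scheme \<Rightarrow> ('n, 'y) ring_scheme \<Rightarrow> ('m \<Rightarrow> 'n) \<Rightarrow> bool" where
  "additive_map M N f \<longleftrightarrow> f \<in> carrier M \<rightarrow> carrier N \<and>
     (\<forall>x\<in>carrier M. \<forall>y\<in>carrier M. f (x \<oplus>\<^bsub>M\<^esub> y) = f x \<oplus>\<^bsub>N\<^esub> f y)"

definition left_linear ::
  "('a, 'z) ring_scheme \<Rightarrow> ('a, 'm, 'x) bimod_scheme \<Rightarrow> ('a, 'n, 'y) bimod_scheme
    \<Rightarrow> ('m \<Rightarrow> 'n) \<Rightarrow> bool" where
  "left_linear A M N f \<longleftrightarrow> additive_map M N f \<and>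
     (\<forall>a\<in>carrier A. \<forall>x\<in>carrier M. f (a \<triangleright>\<^bsub>M\<^esub> x) = a \<triangleright>\<^bsub>N\<^esub> f x)"

definition right_linear ::
  "('a, 'z) ring_scheme \<Rightarrow> ('a, 'm, 'x) bimod_scheme \<Rightarrow> ('a, 'n, 'y) bimod_scheme
    \<Rightarrow> ('m \<Rightarrow> 'n) \<Rightarrow> bool" where
  "right_linear A M N f \<longleftrightarrow> additive_map M N f \<and>
     (\<forall>a\<in>carrier A. \<forall>x\<in>carrier M. f (x \<triangleleft>\<^bsub>M\<^esub> a) = f x \<triangleleft>\<^bsub>N\<^esub> a)"


section \<open>Tensor products\<close>

text \<open>
  The tensor product over \<open>A\<close> of a right module \<open>M\<close> and a left module \<open>N\<close> is the free abelian
  group on \<open>carrier M \<times> carrier N\<close> modulo the subgroup generated by the usual relations.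
\<close>

type_synonym ('m, 'n) tensor = "('m \<times> 'n \<Rightarrow>\<^sub>0 int) set"

definition balance_relations ::
  "('a, 'z) ring_scheme \<Rightarrow> ('a, 'm, 'x) bimod_scheme \<Rightarrow> ('a, 'n, 'y) bimod_scheme
    \<Rightarrow> ('m, 'n) tensor" where
  "balance_relations A M N =
     {frag_of (x \<oplus>\<^bsub>M\<^esub> x', y) - frag_of (x, y) - frag_of (x', y) | x x' y.
        x \<in> carrier M \<and> x' \<in> carrier M \<and> y \<in> carrier N} \<union>
     {frag_of (x, y \<oplus>\<^bsub>N\<^esub> y') - frag_of (x, y) - frag_of (x, y') | x y y'.
        x \<in> carrier M \<and> y \<in> carrier N \<and> y' \<in> carrier N} \<union>
     {frag_of (x \<triangleleft>\<^bsub>M\<^esub> a, y) - frag_of (x, a \<triangleright>\<^bsub>N\<^esub> y) | x a y.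
        x \<in> carrier M \<and> a \<in> carrier A \<and> y \<in> carrier N}"

definition tensor_kernel ::
  "('a, 'z) ring_scheme \<Rightarrow> ('a, 'm, 'x) bimod_scheme \<Rightarrow> ('a, 'n, 'y) bimod_scheme
    \<Rightarrow> ('m, 'n) tensor" where
  "tensor_kernel A M N =
     generate (free_Abelian_group (carrier M \<times> carrier N)) (balance_relations A M N)"

definition pure_tensor ::
  "('a, 'z) ring_scheme \<Rightarrow> ('a, 'm, 'x) bimod_scheme \<Rightarrow> ('a, 'n, 'y) bimod_scheme
    \<Rightarrow> 'm \<Rightarrow> 'n \<Rightarrow> ('m, 'n) tensor" where
  "pure_tensor A M N x y =
     tensor_kernel A M N #>\<^bsub>free_Abelian_group (carrier M \<times> carrier N)\<^esub> frag_of (x, y)"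

text \<open>
  \<open>tensor_lift G b\<close> is the additive map into \<open>G\<close> induced by a balanced biadditive map \<open>b\<close>:
  it sends the class of \<open>\<Sum>\<^sub>i n\<^sub>i (x\<^sub>i, y\<^sub>i)\<close> to \<open>\<Sum>\<^sub>i n\<^sub>i b x\<^sub>i y\<^sub>i\<close>.  The value does not depend on
  the representative when \<open>b\<close> is balanced, so the image of the class is a singleton.
\<close>

definition tensor_lift ::
  "('g, 'z) ring_scheme \<Rightarrow> ('m \<Rightarrow> 'n \<Rightarrow> 'g) \<Rightarrow> ('m, 'n) tensor \<Rightarrow> 'g" where
  "tensor_lift G b T =
     the_elem ((\<lambda>u. \<Oplus>\<^bsub>G\<^esub>p\<in>Poly_Mapping.keys u.
                    [Poly_Mapping.lookup u p] \<cdot>\<^bsub>G\<^esub> b (fst p) (snd p)) ` T)"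

definition tensor_group ::
  "('a, 'z) ring_scheme \<Rightarrow> ('a, 'm, 'x) bimod_scheme \<Rightarrow> ('a, 'n, 'y) bimod_scheme
    \<Rightarrow> ('m, 'n) tensor ring" where
  "tensor_group A M N =
     (let Q = free_Abelian_group (carrier M \<times> carrier N) Mod tensor_kernel A M N
      in \<lparr>carrier = carrier Q, mult = undefined, one = undefined, zero = one Q, add = mult Q\<rparr>)"

text \<open>
  The left action is meaningful when \<open>M\<close> is a bimodule, the right action when \<open>N\<close> is one.
\<close>

definition tensor_prod ::
  "('a, 'z) ring_scheme \<Rightarrow> ('a, 'm, 'x) bimod_scheme \<Rightarrow> ('a, 'n, 'y) bimod_scheme
    \<Rightarrow> ('a, ('m, 'n) tensor) bimod" where
  "tensor_prod A M N = (let G = tensor_group A M N in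
     \<lparr>carrier = carrier G, mult = undefined, one = undefined, zero = zero G, add = add G,
      lact = (\<lambda>a. tensor_lift G (\<lambda>x y. pure_tensor A M N (a \<triangleright>\<^bsub>M\<^esub> x) y)),
      ract = (\<lambda>t a. tensor_lift G (\<lambda>x y. pure_tensor A M N x (y \<triangleleft>\<^bsub>N\<^esub> a)) t)\<rparr>)"

text \<open>\<open>tensor_map A M' N' f g\<close> is \<open>f \<otimes>\<^sub>A g\<close>, where \<open>M'\<close> and \<open>N'\<close> are the codomains.\<close>

definition tensor_map ::
  "('a, 'z) ring_scheme \<Rightarrow> ('a, 'm2, 'x) bimod_scheme \<Rightarrow> ('a, 'n2, 'y) bimod_scheme
    \<Rightarrow> ('m \<Rightarrow> 'm2) \<Rightarrow> ('n \<Rightarrow> 'n2) \<Rightarrow> ('m, 'n) tensor \<Rightarrow> ('m2, 'n2) tensor" where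
  "tensor_map A M' N' f g =
     tensor_lift (tensor_prod A M' N') (\<lambda>x y. pure_tensor A M' N' (f x) (g y))"

text \<open>The isomorphism \<open>M \<otimes> (N \<otimes> P) \<rightarrow> (M \<otimes> N) \<otimes> P\<close>.\<close>

definition tensor_assoc ::
  "('a, 'z) ring_scheme \<Rightarrow> ('a, 'm, 'x) bimod_scheme \<Rightarrow> ('a, 'n, 'y) bimod_scheme
    \<Rightarrow> ('a, 'p, 'w) bimod_scheme
    \<Rightarrow> ('m, ('n, 'p) tensor) tensor \<Rightarrow> (('m, 'n) tensor, 'p) tensor" where
  "tensor_assoc A M N P =
     (let MN = tensor_prod A M N; G = tensor_prod A MN P in
      tensor_lift G (\<lambda>x. tensor_lift G (\<lambda>y z. pure_tensor A MN P (pure_tensor A M N x y) z)))"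


section \<open>Flat modules\<close>

text \<open>
  A right module \<open>M\<close> is flat if \<open>M \<otimes>\<^sub>A -\<close> preserves injectivity of linear maps.  HOL has no
  quantification over types, so the test modules range over all modules with carrier in one
  fixed type.  That type contains a copy of \<open>A\<close>, hence every inclusion of a one-sided ideal into
  \<open>A\<close> (up to isomorphism) occurs among the test maps; as these suffice to detect flatness, the
  definition agrees with flatness with respect to modules of arbitrary size.  It also contains
  copies of \<open>M\<close> and of the tensors over \<open>M\<close>.
\<close>

type_synonym ('a, 'm) test_universe = "'a + 'm + ('m, 'm) tensor"

definition flat_right :: "('a, 'z) ring_scheme \<Rightarrow> ('a, 'm, 'x) bimod_scheme \<Rightarrow> bool" where
  "flat_right A M \<longleftrightarrow> right_module A M \<and>
     (\<forall>(P :: ('a, ('a, 'm) test_universe) bimod) (Q :: ('a, ('a, 'm) test_universe) bimod) f.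
        left_module A P \<longrightarrow> left_module A Q \<longrightarrow> left_linear A P Q f \<longrightarrow> inj_on f (carrier P) \<longrightarrow>
        inj_on (tensor_map A M Q (\<lambda>x. x) f) (carrier (tensor_prod A M P)))"

definition flat_left :: "('a, 'z) ring_scheme \<Rightarrow> ('a, 'm, 'x) bimod_scheme \<Rightarrow> bool" where
  "flat_left A M \<longleftrightarrow> left_module A M \<and>
     (\<forall>(P :: ('a, ('a, 'm) test_universe) bimod) (Q :: ('a, ('a, 'm) test_universe) bimod) f.
        right_module A P \<longrightarrow> right_module A Q \<longrightarrow> right_linear A P Q f \<longrightarrow> inj_on f (carrier P) \<longrightarrow>
        inj_on (tensor_map A Q M f (\<lambda>x. x)) (carrier (tensor_prod A P M)))"


section \<open>Corings, comodules and bicomodules\<close>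

record ('a, 'c) coring = "('a, 'c) bimod" +
  comult :: "'c \<Rightarrow> ('c, 'c) tensor"
  counit :: "'c \<Rightarrow> 'a"

locale coring = bimodule R A C for R (structure) and A (structure) and C (structure) +
  assumes comult_left_linear: "left_linear A C (tensor_prod A C C) (comult C)"
    and comult_right_linear: "right_linear A C (tensor_prod A C C) (comult C)"
    and counit_additive: "additive_map C A (counit C)"
    and counit_lact: "\<lbrakk>a \<in> carrier A; c \<in> carrier C\<rbrakk>
          \<Longrightarrow> counit C (a \<triangleright>\<^bsub>C\<^esub> c) = a \<otimes>\<^bsub>A\<^esub> counit C c"
    and counit_ract: "\<lbrakk>a \<in> carrier A; c \<in> carrier C\<rbrakk>
          \<Longrightarrow> counit C (c \<triangleleft>\<^bsub>C\<^esub> a) = counit C c \<otimes>\<^bsub>A\<^esub> a"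
    and coassoc: "c \<in> carrier C \<Longrightarrow>
          tensor_map A (tensor_prod A C C) C (comult C) (\<lambda>x. x) (comult C c) =
          tensor_assoc A C C C (tensor_map A C (tensor_prod A C C) (\<lambda>x. x) (comult C) (comult C c))"
    and counit_left: "c \<in> carrier C \<Longrightarrow>
          tensor_lift C (\<lambda>x y. counit C x \<triangleright>\<^bsub>C\<^esub> y) (comult C c) = c"
    and counit_right: "c \<in> carrier C \<Longrightarrow>
          tensor_lift C (\<lambda>x y. x \<triangleleft>\<^bsub>C\<^esub> counit C y) (comult C c) = c"

locale right_comodule = coring R A C + right_module A M
  for R (structure) and A (structure) and C (structure) and M (structure)
    and \<rho> :: "'m \<Rightarrow> ('m, 'c) tensor" +
  assumes right_coaction_linear: "right_linear A M (tensor_prod A M C) \<rho>"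
    and right_coaction_coassoc: "x \<in> carrier M \<Longrightarrow>
          tensor_map A (tensor_prod A M C) C \<rho> (\<lambda>c. c) (\<rho> x) =
          tensor_assoc A M C C (tensor_map A M (tensor_prod A C C) (\<lambda>y. y) (comult C) (\<rho> x))"
    and right_coaction_counit: "x \<in> carrier M \<Longrightarrow>
          tensor_lift M (\<lambda>y c. y \<triangleleft>\<^bsub>M\<^esub> counit C c) (\<rho> x) = x"

locale left_comodule = coring R A C + left_module A M
  for R (structure) and A (structure) and C (structure) and M (structure)
    and \<sigma> :: "'m \<Rightarrow> ('c, 'm) tensor" +
  assumes left_coaction_linear: "left_linear A M (tensor_prod A C M) \<sigma>"
    and left_coaction_coassoc: "x \<in> carrier M \<Longrightarrow>
          tensor_map A (tensor_prod A C C) M (comult C) (\<lambda>y. y) (\<sigma> x) =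
          tensor_assoc A C C M (tensor_map A C (tensor_prod A C M) (\<lambda>c. c) \<sigma> (\<sigma> x))"
    and left_coaction_counit: "x \<in> carrier M \<Longrightarrow>
          tensor_lift M (\<lambda>c y. counit C c \<triangleright>\<^bsub>M\<^esub> y) (\<sigma> x) = x"

locale bicomodule = bimodule R A M + right_comodule R A C M \<rho> + left_comodule R A C M \<sigma>
  for R (structure) and A (structure) and C (structure) and M (structure)
    and \<sigma> :: "'m \<Rightarrow> ('c, 'm) tensor" and \<rho> :: "'m \<Rightarrow> ('m, 'c) tensor" +
  assumes left_coaction_right_linear: "right_linear A M (tensor_prod A C M) \<sigma>"
    and right_coaction_left_linear: "left_linear A M (tensor_prod A M C) \<rho>"
    and coactions_commute: "x \<in> carrier M \<Longrightarrow>
          tensor_map A (tensor_prod A C M) C \<sigma> (\<lambda>c. c) (\<rho> x) =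
          tensor_assoc A C M C (tensor_map A C (tensor_prod A M C) (\<lambda>c. c) \<rho> (\<sigma> x))"

definition right_colinear ::
  "('a, 'z) ring_scheme \<Rightarrow> ('a, 'c, 'w) coring_scheme
    \<Rightarrow> ('a, 'm, 'x) bimod_scheme \<Rightarrow> ('m \<Rightarrow> ('m, 'c) tensor)
    \<Rightarrow> ('a, 'n, 'y) bimod_scheme \<Rightarrow> ('n \<Rightarrow> ('n, 'c) tensor) \<Rightarrow> ('m \<Rightarrow> 'n) \<Rightarrow> bool" where
  "right_colinear A C M \<rho>M N \<rho>N f \<longleftrightarrow> right_linear A M N f \<and>
     (\<forall>x\<in>carrier M. \<rho>N (f x) = tensor_map A N C f (\<lambda>c. c) (\<rho>M x))"

definition left_colinear ::
  "('a, 'z) ring_scheme \<Rightarrow> ('a, 'c, 'w) coring_scheme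
    \<Rightarrow> ('a, 'm, 'x) bimod_scheme \<Rightarrow> ('m \<Rightarrow> ('c, 'm) tensor)
    \<Rightarrow> ('a, 'n, 'y) bimod_scheme \<Rightarrow> ('n \<Rightarrow> ('c, 'n) tensor) \<Rightarrow> ('m \<Rightarrow> 'n) \<Rightarrow> bool" where
  "left_colinear A C M \<sigma>M N \<sigma>N f \<longleftrightarrow> left_linear A M N f \<and>
     (\<forall>x\<in>carrier M. \<sigma>N (f x) = tensor_map A C N (\<lambda>c. c) f (\<sigma>M x))"

text \<open>
  A subcomodule is a subset carrying a comodule structure, with the inherited module structure,
  for which the inclusion is a morphism of comodules; likewise for bicomodules.
\<close>

definition right_subcomodules ::
  "('r, 'q) ring_scheme \<Rightarrow> ('r, 'a, 'z) module_scheme \<Rightarrow> ('a, 'c, 'w) coring_scheme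
    \<Rightarrow> ('a, 'm, 'x) bimod_scheme \<Rightarrow> ('m \<Rightarrow> ('m, 'c) tensor) \<Rightarrow> 'm set set" where
  "right_subcomodules R A C M \<rho> =
     {K. K \<subseteq> carrier M \<and>
        (\<exists>\<rho>K. right_comodule R A C (M\<lparr>carrier := K\<rparr>) \<rho>K \<and>
              right_colinear A C (M\<lparr>carrier := K\<rparr>) \<rho>K M \<rho> (\<lambda>x. x))}"

definition left_subcomodules ::
  "('r, 'q) ring_scheme \<Rightarrow> ('r, 'a, 'z) module_scheme \<Rightarrow> ('a, 'c, 'w) coring_scheme
    \<Rightarrow> ('a, 'm, 'x) bimod_scheme \<Rightarrow> ('m \<Rightarrow> ('c, 'm) tensor) \<Rightarrow> 'm set set" where
  "left_subcomodules R A C M \<sigma> =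
     {K. K \<subseteq> carrier M \<and>
        (\<exists>\<sigma>K. left_comodule R A C (M\<lparr>carrier := K\<rparr>) \<sigma>K \<and>
              left_colinear A C (M\<lparr>carrier := K\<rparr>) \<sigma>K M \<sigma> (\<lambda>x. x))}"

definition subbicomodules ::
  "('r, 'q) ring_scheme \<Rightarrow> ('r, 'a, 'z) module_scheme \<Rightarrow> ('a, 'c, 'w) coring_scheme
    \<Rightarrow> ('a, 'm, 'x) bimod_scheme \<Rightarrow> ('m \<Rightarrow> ('c, 'm) tensor) \<Rightarrow> ('m \<Rightarrow> ('m, 'c) tensor)
    \<Rightarrow> 'm set set" where
  "subbicomodules R A C M \<sigma> \<rho> =
     {K. K \<subseteq> carrier M \<and>
        (\<exists>\<sigma>K \<rho>K. bicomodule R A C (M\<lparr>carrier := K\<rparr>) \<sigma>K \<rho>K \<and>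
              left_colinear A C (M\<lparr>carrier := K\<rparr>) \<sigma>K M \<sigma> (\<lambda>x. x) \<and>
              right_colinear A C (M\<lparr>carrier := K\<rparr>) \<rho>K M \<rho> (\<lambda>x. x))}"


section \<open>Fully coprime subobjects\<close>

text \<open>
  In what follows \<open>E\<close> is the set of endomorphisms of \<open>M\<close> in the category at hand and \<open>S\<close> the set
  of its subobjects.  The multiplication of the endomorphism ring, hence the passage to the
  opposite ring, plays no role in these notions.
\<close>

definition fully_invariant :: "('m \<Rightarrow> 'm) set \<Rightarrow> 'm set \<Rightarrow> bool" where
  "fully_invariant E L \<longleftrightarrow> (\<forall>f\<in>E. f ` L \<subseteq> L)"

definition An :: "('m, 'x) ring_scheme \<Rightarrow> ('m \<Rightarrow> 'm) set \<Rightarrow> 'm set \<Rightarrow> ('m \<Rightarrow> 'm) set" where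
  "An M E X = {f \<in> E. \<forall>x\<in>X. f x = \<zero>\<^bsub>M\<^esub>}"

definition internal_coproduct ::
  "('m, 'x) ring_scheme \<Rightarrow> ('m \<Rightarrow> 'm) set \<Rightarrow> 'm set \<Rightarrow> 'm set \<Rightarrow> 'm set" where
  "internal_coproduct M E X Y = {m \<in> carrier M. \<forall>f\<in>An M E X. f m \<in> Y}"

definition fully_coprime ::
  "('m, 'x) ring_scheme \<Rightarrow> ('m \<Rightarrow> 'm) set \<Rightarrow> 'm set set \<Rightarrow> 'm set \<Rightarrow> bool" where
  "fully_coprime M E S K \<longleftrightarrow> K \<in> S \<and> fully_invariant E K \<and> K \<noteq> {\<zero>\<^bsub>M\<^esub>} \<and>
     (\<forall>X\<in>S. \<forall>Y\<in>S. fully_invariant E X \<longrightarrow> fully_invariant E Y \<longrightarrow>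
        K \<subseteq> internal_coproduct M E X Y \<longrightarrow> K \<subseteq> X \<or> K \<subseteq> Y)"


section \<open>The fully coprime spectra of a coring\<close>

definition bicoideals ::
  "('r, 'q) ring_scheme \<Rightarrow> ('r, 'a, 'z) module_scheme \<Rightarrow> ('a, 'c, 'w) coring_scheme
    \<Rightarrow> 'c set set" where
  "bicoideals R A C = subbicomodules R A C C (comult C) (comult C)"

definition right_coideals ::
  "('r, 'q) ring_scheme \<Rightarrow> ('r, 'a, 'z) module_scheme \<Rightarrow> ('a, 'c, 'w) coring_scheme
    \<Rightarrow> 'c set set" where
  "right_coideals R A C = right_subcomodules R A C C (comult C)"

definition left_coideals ::
  "('r, 'q) ring_scheme \<Rightarrow> ('r, 'a, 'z) module_scheme \<Rightarrow> ('a, 'c, 'w) coring_scheme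
    \<Rightarrow> 'c set set" where
  "left_coideals R A C = left_subcomodules R A C C (comult C)"

definition End_right ::
  "('a, 'z) ring_scheme \<Rightarrow> ('a, 'c, 'w) coring_scheme \<Rightarrow> ('c \<Rightarrow> 'c) set" where
  "End_right A C = {f. right_colinear A C C (comult C) C (comult C) f}"

definition End_left ::
  "('a, 'z) ring_scheme \<Rightarrow> ('a, 'c, 'w) coring_scheme \<Rightarrow> ('c \<Rightarrow> 'c) set" where
  "End_left A C = {f. left_colinear A C C (comult C) C (comult C) f}"

definition End_bi ::
  "('a, 'z) ring_scheme \<Rightarrow> ('a, 'c, 'w) coring_scheme \<Rightarrow> ('c \<Rightarrow> 'c) set" where
  "End_bi A C = End_left A C \<inter> End_right A C"

definition CPSpec ::
  "('r, 'q) ring_scheme \<Rightarrow> ('r, 'a, 'z) module_scheme \<Rightarrow> ('a, 'c, 'w) coring_scheme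
    \<Rightarrow> 'c set set" where
  "CPSpec R A C =
     {K \<in> bicoideals R A C. fully_coprime C (End_bi A C) (bicoideals R A C) K}"

definition CPSpec_right ::
  "('r, 'q) ring_scheme \<Rightarrow> ('r, 'a, 'z) module_scheme \<Rightarrow> ('a, 'c, 'w) coring_scheme
    \<Rightarrow> 'c set set" where
  "CPSpec_right R A C =
     {K \<in> bicoideals R A C. fully_coprime C (End_right A C) (right_coideals R A C) K}"

definition CPSpec_left ::
  "('r, 'q) ring_scheme \<Rightarrow> ('r, 'a, 'z) module_scheme \<Rightarrow> ('a, 'c, 'w) coring_scheme
    \<Rightarrow> 'c set set" where
  "CPSpec_left R A C =
     {K \<in> bicoideals R A C. fully_coprime C (End_left A C) (left_coideals R A C) K}"

definition not_below :: "'c set set \<Rightarrow> 'c set \<Rightarrow> 'c set set" where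
  "not_below spec L = {K \<in> spec. \<not> K \<subseteq> L}"

definition tau_bi ::
  "('r, 'q) ring_scheme \<Rightarrow> ('r, 'a, 'z) module_scheme \<Rightarrow> ('a, 'c, 'w) coring_scheme
    \<Rightarrow> 'c set set set" where
  "tau_bi R A C = {not_below (CPSpec R A C) L | L. L \<in> bicoideals R A C}"

definition tau_fi_right ::
  "('r, 'q) ring_scheme \<Rightarrow> ('r, 'a, 'z) module_scheme \<Rightarrow> ('a, 'c, 'w) coring_scheme
    \<Rightarrow> 'c set set set" where
  "tau_fi_right R A C = {not_below (CPSpec_right R A C) L | L.
     L \<in> right_coideals R A C \<and> fully_invariant (End_right A C) L}"

definition tau_fi_left ::
  "('r, 'q) ring_scheme \<Rightarrow> ('r, 'a, 'z) module_scheme \<Rightarrow> ('a, 'c, 'w) coring_scheme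
    \<Rightarrow> 'c set set set" where
  "tau_fi_left R A C = {not_below (CPSpec_left R A C) L | L.
     L \<in> left_coideals R A C \<and> fully_invariant (End_left A C) L}"

definition is_topological_space :: "'p set \<Rightarrow> 'p set set \<Rightarrow> bool" where
  "is_topological_space X \<tau> \<longleftrightarrow> (\<exists>T. topspace T = X \<and> {U. openin T U} = \<tau>)"

end

theory Submission
  imports Defs
begin

text \<open>
  The topological part needs very little about comodules.  For a set \<open>spec\<close> of fully coprime
  subobjects of \<open>M\<close> and any additive subgroup \<open>X\<close> of \<open>M\<close>, subobject or not, consider the set
  \<open>not_below spec X\<close> of points that are not contained in \<open>X\<close>.  The union of such sets for
  \<open>X\<^sub>i\<close> is the set for \<open>\<Inter>X\<^sub>i\<close>, and full coprimeness says exactly that the intersection of the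
  sets for fully invariant subobjects \<open>X\<close> and \<open>Y\<close> is the set for \<open>(X :\<^sub>M Y)\<close>.  Infinite intersections
  of subcomodules, and \<open>(X :\<^sub>M Y)\<close> itself, may fail to be subcomodules, but this does no harm.  A
  point of the spectrum is a fully invariant subobject, hence it lies in \<open>X\<close> if and only if it lies
  in the sum of all fully invariant subobjects contained in \<open>X\<close>.  So the open sets are the sets
  \<open>not_below spec X\<close> for all additive subgroups \<open>X\<close>, as soon as sums of subobjects are subobjects
  (\<open>is_topological_space_fully_coprime\<close>).

  It remains to see that sums of right coideals, left coideals and bicoideals are again such.  This
  is where flatness enters.  If \<open>K\<close> is a right submodule of \<open>C\<close>, then \<open>K \<otimes> C \<rightarrow> C \<otimes> C\<close> and
  \<open>(K \<otimes> C) \<otimes> C \<rightarrow> (C \<otimes> C) \<otimes> C\<close> are injective.  Hence the comultiplication restricts to a map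
  \<open>K \<rightarrow> K \<otimes> C\<close> once the image of \<open>K\<close> lies in that of \<open>K \<otimes> C\<close>, and the comodule axioms for this
  restriction follow from those of the coring, because they may be tested in \<open>(C \<otimes> C) \<otimes> C\<close>.  So \<open>K\<close>
  is a right coideal if and only if \<open>\<Delta>(K)\<close> lies in the image of \<open>K \<otimes> C\<close> (\<open>right_coideal_iff\<close>), a
  condition that visibly passes to sums.  Left coideals are treated in the same way, with one use of
  the associativity isomorphism, and a bicoideal is the same as a left and right coideal
  (\<open>bicoideals_eq\<close>).

  All statements about tensor products are derived from the universal property and from the fact
  that pure tensors generate: additive maps agree when they agree on pure tensors.
\<close>

section \<open>Additive maps\<close>

lemma additive_map_closed: "additive_map M N f \<Longrightarrow> x \<in> carrier M \<Longrightarrow> f x \<in> carrier N"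
  by (auto simp: additive_map_def)

lemma additive_map_add:
  "additive_map M N f \<Longrightarrow> x \<in> carrier M \<Longrightarrow> y \<in> carrier M \<Longrightarrow> f (x \<oplus>\<^bsub>M\<^esub> y) = f x \<oplus>\<^bsub>N\<^esub> f y"
  by (auto simp: additive_map_def)

lemma additive_map_id: "additive_map M M (\<lambda>x. x)"
  by (auto simp: additive_map_def)

lemma additive_map_comp:
  "additive_map M N f \<Longrightarrow> additive_map N P g \<Longrightarrow> additive_map M P (\<lambda>x. g (f x))"
  by (auto simp: additive_map_def Pi_iff)

lemma additive_map_group_hom:
  assumes "abelian_group M" "abelian_group N" "additive_map M N f"
  shows "group_hom (add_monoid M) (add_monoid N) f"
  using assms
  by (intro group_hom.intro group_hom_axioms.intro abelian_group.a_group)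
    (auto simp: hom_def additive_map_def)

lemma additive_map_zero:
  assumes "abelian_group M" "abelian_group N" "additive_map M N f"
  shows "f \<zero>\<^bsub>M\<^esub> = \<zero>\<^bsub>N\<^esub>"
  using group_hom.hom_one[OF additive_map_group_hom[OF assms]] by simp

lemma left_linear_additive: "left_linear A M N f \<Longrightarrow> additive_map M N f"
  by (simp add: left_linear_def)

lemma right_linear_additive: "right_linear A M N f \<Longrightarrow> additive_map M N f"
  by (simp add: right_linear_def)

lemma left_linear_id: "left_linear A M M (\<lambda>x. x)"
  by (simp add: left_linear_def additive_map_id)

lemma right_linear_id: "right_linear A M M (\<lambda>x. x)"
  by (simp add: right_linear_def additive_map_id)

lemma left_linear_comp:
  "left_linear A M N f \<Longrightarrow> left_linear A N P g \<Longrightarrow> left_linear A M P (\<lambda>x. g (f x))"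
  by (auto simp: left_linear_def additive_map_closed intro: additive_map_comp)

lemma right_linear_comp:
  "right_linear A M N f \<Longrightarrow> right_linear A N P g \<Longrightarrow> right_linear A M P (\<lambda>x. g (f x))"
  by (auto simp: right_linear_def additive_map_closed intro: additive_map_comp)


section \<open>The universal property of the tensor product\<close>

definition balanced ::
  "('a, 'z) ring_scheme \<Rightarrow> ('a, 'm, 'x) bimod_scheme \<Rightarrow> ('a, 'n, 'y) bimod_scheme
    \<Rightarrow> ('g, 'w) ring_scheme \<Rightarrow> ('m \<Rightarrow> 'n \<Rightarrow> 'g) \<Rightarrow> bool" where
  "balanced A M N G b \<longleftrightarrow>
     (\<forall>y\<in>carrier N. additive_map M G (\<lambda>x. b x y)) \<and>
     (\<forall>x\<in>carrier M. additive_map N G (b x)) \<and>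
     (\<forall>x\<in>carrier M. \<forall>a\<in>carrier A. \<forall>y\<in>carrier N. b (x \<triangleleft>\<^bsub>M\<^esub> a) y = b x (a \<triangleright>\<^bsub>N\<^esub> y))"

lemma balancedI:
  assumes "\<And>x y. x \<in> carrier M \<Longrightarrow> y \<in> carrier N \<Longrightarrow> b x y \<in> carrier G"
    and "\<And>x x' y. x \<in> carrier M \<Longrightarrow> x' \<in> carrier M \<Longrightarrow> y \<in> carrier N \<Longrightarrow>
           b (x \<oplus>\<^bsub>M\<^esub> x') y = b x y \<oplus>\<^bsub>G\<^esub> b x' y"
    and "\<And>x y y'. x \<in> carrier M \<Longrightarrow> y \<in> carrier N \<Longrightarrow> y' \<in> carrier N \<Longrightarrow>
           b x (y \<oplus>\<^bsub>N\<^esub> y') = b x y \<oplus>\<^bsub>G\<^esub> b x y'"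
    and "\<And>x a y. x \<in> carrier M \<Longrightarrow> a \<in> carrier A \<Longrightarrow> y \<in> carrier N \<Longrightarrow>
           b (x \<triangleleft>\<^bsub>M\<^esub> a) y = b x (a \<triangleright>\<^bsub>N\<^esub> y)"
  shows "balanced A M N G b"
  using assms by (auto simp: balanced_def additive_map_def)

lemma balancedD:
  assumes "balanced A M N G b"
  shows "x \<in> carrier M \<Longrightarrow> y \<in> carrier N \<Longrightarrow> b x y \<in> carrier G"
    and "x \<in> carrier M \<Longrightarrow> x' \<in> carrier M \<Longrightarrow> y \<in> carrier N \<Longrightarrow>
           b (x \<oplus>\<^bsub>M\<^esub> x') y = b x y \<oplus>\<^bsub>G\<^esub> b x' y"
    and "x \<in> carrier M \<Longrightarrow> y \<in> carrier N \<Longrightarrow> y' \<in> carrier N \<Longrightarrow>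
           b x (y \<oplus>\<^bsub>N\<^esub> y') = b x y \<oplus>\<^bsub>G\<^esub> b x y'"
    and "x \<in> carrier M \<Longrightarrow> a \<in> carrier A \<Longrightarrow> y \<in> carrier N \<Longrightarrow>
           b (x \<triangleleft>\<^bsub>M\<^esub> a) y = b x (a \<triangleright>\<^bsub>N\<^esub> y)"
  using assms by (auto simp: balanced_def additive_map_def)

text \<open>
  The map on representatives that underlies \<^const>\<open>tensor_lift\<close>.
\<close>

definition free_lift :: "('g, 'z) ring_scheme \<Rightarrow> ('m \<Rightarrow> 'n \<Rightarrow> 'g) \<Rightarrow> ('m \<times> 'n \<Rightarrow>\<^sub>0 int) \<Rightarrow> 'g" where
  "free_lift G b u =
     (\<Oplus>\<^bsub>G\<^esub>p\<in>Poly_Mapping.keys u. [Poly_Mapping.lookup u p] \<cdot>\<^bsub>G\<^esub> b (fst p) (snd p))"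

text \<open>
  Two elements of the free group have different supports; summing over any common finite superset
  makes the lift visibly additive.
\<close>

lemma free_lift_superset:
  fixes u :: "'m \<times> 'n \<Rightarrow>\<^sub>0 int"
  assumes "abelian_group G" "finite F" "Poly_Mapping.keys u \<subseteq> F"
    and "\<And>p. p \<in> F \<Longrightarrow> b (fst p) (snd p) \<in> carrier G"
  shows "free_lift G b u = (\<Oplus>\<^bsub>G\<^esub>p\<in>F. [Poly_Mapping.lookup u p] \<cdot>\<^bsub>G\<^esub> b (fst p) (snd p))"
proof -
  interpret abelian_group G by fact
  show ?thesis
    unfolding free_lift_def
  proof (rule add.finprod_mono_neutral_cong_left)
    show "[poly_mapping.lookup u i] \<cdot>\<^bsub>G\<^esub> b (fst i) (snd i) = \<zero>\<^bsub>G\<^esub>"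
      if "i \<in> F - Poly_Mapping.keys u" for i
      using that by (simp add: in_keys_iff add_pow_def)
  qed (use assms in auto)
qed

lemma free_lift_hom:
  assumes "abelian_group G"
    and "\<And>x y. x \<in> X \<Longrightarrow> y \<in> Y \<Longrightarrow> b x y \<in> carrier G"
  shows "group_hom (free_Abelian_group (X \<times> Y)) (add_monoid G) (free_lift G b)"
proof (rule group_hom.intro)
  interpret abelian_group G by fact
  show "group (add_monoid G)" by (rule a_group)
  show "group_hom_axioms (free_Abelian_group (X \<times> Y)) (add_monoid G) (free_lift G b)"
  proof (intro group_hom_axioms.intro homI; clarsimp)
    fix u :: "_ \<Rightarrow>\<^sub>0 int" assume u: "Poly_Mapping.keys u \<subseteq> X \<times> Y"
    then show "free_lift G b u \<in> carrier G"
      unfolding free_lift_def using assms(2) by (intro finsum_closed) fastforce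
    fix v :: "_ \<Rightarrow>\<^sub>0 int" assume v: "Poly_Mapping.keys v \<subseteq> X \<times> Y"
    let ?F = "Poly_Mapping.keys u \<union> Poly_Mapping.keys v"
    have b: "b (fst p) (snd p) \<in> carrier G" if "p \<in> ?F" for p
      using that u v assms(2) by auto
    have "free_lift G b (u + v) =
        (\<Oplus>\<^bsub>G\<^esub>p\<in>?F. [Poly_Mapping.lookup (u + v) p] \<cdot>\<^bsub>G\<^esub> b (fst p) (snd p))"
      using b by (intro free_lift_superset assms(1)) (auto simp: keys_add)
    also have "\<dots> = (\<Oplus>\<^bsub>G\<^esub>p\<in>?F. [Poly_Mapping.lookup u p] \<cdot>\<^bsub>G\<^esub> b (fst p) (snd p) \<oplus>\<^bsub>G\<^esub>
                            [Poly_Mapping.lookup v p] \<cdot>\<^bsub>G\<^esub> b (fst p) (snd p))"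
      using b by (intro finsum_cong') (auto simp: Poly_Mapping.lookup_add add.int_pow_mult)
    also have "\<dots> = (\<Oplus>\<^bsub>G\<^esub>p\<in>?F. [Poly_Mapping.lookup u p] \<cdot>\<^bsub>G\<^esub> b (fst p) (snd p)) \<oplus>\<^bsub>G\<^esub>
                     (\<Oplus>\<^bsub>G\<^esub>p\<in>?F. [Poly_Mapping.lookup v p] \<cdot>\<^bsub>G\<^esub> b (fst p) (snd p))"
      using b by (intro finsum_addf) auto
    also have "\<dots> = free_lift G b u \<oplus>\<^bsub>G\<^esub> free_lift G b v"
      using b by (subst (1 2) free_lift_superset[OF assms(1), of ?F]) auto
    finally show "free_lift G b (u + v) = free_lift G b u \<oplus>\<^bsub>G\<^esub> free_lift G b v" .
  qed
qed simp

lemma free_lift_frag_of: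
  assumes "abelian_group G" "b x y \<in> carrier G"
  shows "free_lift G b (frag_of (x, y)) = b x y"
proof -
  interpret abelian_group G by fact
  have "b x y \<oplus>\<^bsub>G\<^esub> \<zero>\<^bsub>G\<^esub> = b x y" "[(1::int)] \<cdot>\<^bsub>G\<^esub> b x y = b x y"
    using assms(2) by (auto simp: add.int_pow_1)
  then show ?thesis
    using assms(2) by (simp add: free_lift_def)
qed

context
  fixes A :: "('a, 'z) ring_scheme" and M :: "('a, 'm, 'x) bimod_scheme"
    and N :: "('a, 'n, 'y) bimod_scheme"
  assumes M: "right_module A M" and N: "left_module A N"
begin

interpretation M: right_module A M by (rule M)
interpretation N: left_module A N by (rule N)

private abbreviation (input) "F \<equiv> free_Abelian_group (carrier M \<times> carrier N)"
private abbreviation (input) "H \<equiv> tensor_kernel A M N"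
private abbreviation (input) "cls u \<equiv> H #>\<^bsub>F\<^esub> u"
private abbreviation (input) "T \<equiv> tensor_prod A M N"

lemma balance_relations_carrier: "balance_relations A M N \<subseteq> carrier F"
proof -
  have "Poly_Mapping.keys (u - v) \<subseteq> carrier M \<times> carrier N"
    if "Poly_Mapping.keys u \<subseteq> carrier M \<times> carrier N" "Poly_Mapping.keys v \<subseteq> carrier M \<times> carrier N"
    for u v :: "'m \<times> 'n \<Rightarrow>\<^sub>0 int"
    using that keys_diff[of u v] by blast
  then show ?thesis
    unfolding balance_relations_def by (clarify, elim UnE CollectE exE) (simp_all add: M.ract_closed N.lact_closed)
qed

lemma tensor_kernel_subgroup: "subgroup H F"
  unfolding tensor_kernel_def
  by (intro group.generate_is_subgroup balance_relations_carrier) simp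

lemma tensor_kernel_normal: "H \<lhd> F"
  by (intro comm_group.subgroup_imp_normal abelian_free_Abelian_group tensor_kernel_subgroup)

lemma carrier_tensor_prod: "carrier T = cls ` carrier F"
  by (simp add: tensor_prod_def tensor_group_def Let_def carrier_FactGroup)

lemma add_tensor_prod:
  "u \<in> carrier F \<Longrightarrow> v \<in> carrier F \<Longrightarrow> cls u \<oplus>\<^bsub>T\<^esub> cls v = cls (u + v)"
  using normal.rcos_sum[OF tensor_kernel_normal, of u v]
  by (simp add: tensor_prod_def tensor_group_def Let_def)

lemma abelian_group_tensor_prod: "abelian_group T"
proof -
  have "comm_group (F Mod H)"
    by (intro comm_group.abelian_FactGroup abelian_free_Abelian_group tensor_kernel_subgroup)
  note Q = comm_groupE[OF this]
  show ?thesis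
    by (rule abelian_groupI)
      (use Q in \<open>simp_all add: tensor_prod_def tensor_group_def Let_def\<close>)
qed

lemma cls_eqI:
  assumes "u \<in> carrier F" "v \<in> carrier F" "u - v \<in> H"
  shows "cls u = cls v"
proof -
  have "u \<in> cls v"
    unfolding r_coset_def using assms(3) by (auto intro!: bexI[of _ "u - v"])
  then show ?thesis
    using group.repr_independence[OF group_free_Abelian_group _ _ tensor_kernel_subgroup] assms
    by metis
qed

lemma pure_tensor_balanced: "balanced A M N T (pure_tensor A M N)"
proof -
  have rel: "r \<in> H" if "r \<in> balance_relations A M N" for r
    using that unfolding tensor_kernel_def by (rule generate.incl)
  have keys: "Poly_Mapping.keys (frag_of p + frag_of q) \<subseteq> carrier M \<times> carrier N"
    if "p \<in> carrier M \<times> carrier N" "q \<in> carrier M \<times> carrier N" for p q :: "'m \<times> 'n"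
    using that keys_add[of "frag_of p" "frag_of q"] by auto
  show ?thesis
  proof (rule balancedI)
    show "pure_tensor A M N x y \<in> carrier T" if "x \<in> carrier M" "y \<in> carrier N" for x y
      using that by (auto simp: pure_tensor_def carrier_tensor_prod)
    show "pure_tensor A M N (x \<oplus>\<^bsub>M\<^esub> x') y = pure_tensor A M N x y \<oplus>\<^bsub>T\<^esub> pure_tensor A M N x' y"
      if "x \<in> carrier M" "x' \<in> carrier M" "y \<in> carrier N" for x x' y
    proof -
      have "frag_of (x \<oplus>\<^bsub>M\<^esub> x', y) - (frag_of (x, y) + frag_of (x', y)) \<in> H"
        by (rule rel) (use that in \<open>auto simp: balance_relations_def diff_diff_eq\<close>)
      then show ?thesis
        unfolding pure_tensor_def using that keys
        by (subst add_tensor_prod) (simp_all, intro cls_eqI, auto)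
    qed
    show "pure_tensor A M N x (y \<oplus>\<^bsub>N\<^esub> y') = pure_tensor A M N x y \<oplus>\<^bsub>T\<^esub> pure_tensor A M N x y'"
      if "x \<in> carrier M" "y \<in> carrier N" "y' \<in> carrier N" for x y y'
    proof -
      have "frag_of (x, y \<oplus>\<^bsub>N\<^esub> y') - (frag_of (x, y) + frag_of (x, y')) \<in> H"
        by (rule rel) (use that in \<open>auto simp: balance_relations_def diff_diff_eq\<close>)
      then show ?thesis
        unfolding pure_tensor_def using that keys
        by (subst add_tensor_prod) (simp_all, intro cls_eqI, auto)
    qed
    show "pure_tensor A M N (x \<triangleleft>\<^bsub>M\<^esub> a) y = pure_tensor A M N x (a \<triangleright>\<^bsub>N\<^esub> y)"
      if "x \<in> carrier M" "a \<in> carrier A" "y \<in> carrier N" for x a y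
    proof -
      have "frag_of (x \<triangleleft>\<^bsub>M\<^esub> a, y) - frag_of (x, a \<triangleright>\<^bsub>N\<^esub> y) \<in> H"
        by (rule rel) (use that in \<open>auto simp: balance_relations_def\<close>)
      then show ?thesis
        unfolding pure_tensor_def using that
        by (intro cls_eqI) (auto simp: M.ract_closed N.lact_closed)
    qed
  qed
qed

text \<open>
  A class is a sum of pure tensors and of inverses of pure tensors, and the latter are pure again, as
  \<open>- (x \<otimes> y) = (- x) \<otimes> y\<close>.  So no case for inverses is required.
\<close>

lemma tensor_induct [consumes 1, case_names pure add]:
  assumes t: "t \<in> carrier T"
    and pure: "\<And>x y. x \<in> carrier M \<Longrightarrow> y \<in> carrier N \<Longrightarrow> P (pure_tensor A M N x y)"
    and add: "\<And>s t. s \<in> carrier T \<Longrightarrow> t \<in> carrier T \<Longrightarrow> P s \<Longrightarrow> P t \<Longrightarrow> P (s \<oplus>\<^bsub>T\<^esub> t)"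
  shows "P t"
proof -
  interpret T: abelian_group T by (rule abelian_group_tensor_prod)
  note b = balancedD[OF pure_tensor_balanced]
  have additive: "additive_map M T (\<lambda>x. pure_tensor A M N x y)" if "y \<in> carrier N" for y
    using pure_tensor_balanced that by (auto simp: balanced_def)
  have add_cls: "P (cls (u + v))"
    if "u \<in> carrier F" "v \<in> carrier F" "P (cls u)" "P (cls v)" for u v
    unfolding add_tensor_prod[OF that(1,2), symmetric]
    by (rule add) (use that in \<open>auto simp only: carrier_tensor_prod\<close>)
  have zero: "cls 0 = \<zero>\<^bsub>T\<^esub>"
    using group.coset_mult_one[of F H] subgroup.subset[OF tensor_kernel_subgroup]
    by (simp add: tensor_prod_def tensor_group_def Let_def)
  have pure_zero: "pure_tensor A M N \<zero>\<^bsub>M\<^esub> y = \<zero>\<^bsub>T\<^esub>" if "y \<in> carrier N" for y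
    using additive_map_zero[OF M.abelian_group_axioms T.abelian_group_axioms additive[OF that]] .
  \<comment> \<open>Carrying the inverse along turns the induction over differences into one over sums.\<close>
  have "P (cls u) \<and> P (cls (- u))" if "Poly_Mapping.keys u \<subseteq> carrier M \<times> carrier N" for u
  proof (rule free_Abelian_group_induct[OF that])
    have "P (pure_tensor A M N \<zero>\<^bsub>M\<^esub> \<zero>\<^bsub>N\<^esub>)" by (intro pure) auto
    then have "P \<zero>\<^bsub>T\<^esub>" by (simp only: pure_zero N.zero_closed)
    then show "P (cls 0) \<and> P (cls (- 0))" by (simp only: zero minus_zero)
  next
    fix u v
    assume "Poly_Mapping.keys u \<subseteq> carrier M \<times> carrier N" "Poly_Mapping.keys v \<subseteq> carrier M \<times> carrier N"
      "P (cls u) \<and> P (cls (- u))" "P (cls v) \<and> P (cls (- v))"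
    then have "P (cls (u + (- v)))" "P (cls (v + (- u)))"
      by (intro add_cls; simp)+
    then show "P (cls (u - v)) \<and> P (cls (- (u - v)))" by simp
  next
    fix p assume p_in: "p \<in> carrier M \<times> carrier N"
    obtain x y where p: "p = (x, y)" and xy: "x \<in> carrier M" "y \<in> carrier N" using p_in by auto
    have in_T: "cls u \<in> carrier T" if "u \<in> carrier F" for u
      using that by (simp add: carrier_tensor_prod)
    have "pure_tensor A M N (\<ominus>\<^bsub>M\<^esub> x) y \<oplus>\<^bsub>T\<^esub> cls (frag_of p) = \<zero>\<^bsub>T\<^esub>"
      using b(2)[of "\<ominus>\<^bsub>M\<^esub> x" x y] xy pure_zero[of y] by (simp add: M.l_neg p pure_tensor_def)
    moreover have "cls (- frag_of p) \<oplus>\<^bsub>T\<^esub> cls (frag_of p) = \<zero>\<^bsub>T\<^esub>"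
      using p_in by (simp add: add_tensor_prod zero)
    moreover have "cls (- frag_of p) \<in> carrier T" "cls (frag_of p) \<in> carrier T"
      using p_in by (auto intro!: in_T)
    ultimately have "cls (- frag_of p) = pure_tensor A M N (\<ominus>\<^bsub>M\<^esub> x) y"
      using b(1)[of "\<ominus>\<^bsub>M\<^esub> x" y] xy
      by (subst T.add.right_cancel[of "cls (frag_of p)", symmetric]) simp_all
    then show "P (cls (frag_of p)) \<and> P (cls (- frag_of p))"
      using pure[of x y] pure[of "\<ominus>\<^bsub>M\<^esub> x" y] xy p by (simp add: pure_tensor_def)
  qed
  with t show ?thesis by (auto simp: carrier_tensor_prod)
qed

text \<open>
  The lift to the free group kills the balance relations, hence it is constant on each coset and the
  image of a coset is a singleton.
\<close>

lemma tensor_lift_cls: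
  assumes G: "abelian_group G" and b: "balanced A M N G b" and u: "u \<in> carrier F"
  shows "tensor_lift G b (cls u) = free_lift G b u"
proof -
  interpret G: abelian_group G by (rule G)
  interpret h: group_hom F "add_monoid G" "free_lift G b"
    by (rule free_lift_hom[OF G]) (rule balancedD(1)[OF b])
  note bD = balancedD[OF b]
  have fr: "free_lift G b (frag_of (x, y)) = b x y" if "x \<in> carrier M" "y \<in> carrier N" for x y
    using free_lift_frag_of[OF G, of b x y] bD(1) that by simp
  have hdiff: "free_lift G b (v - w) = free_lift G b v \<ominus>\<^bsub>G\<^esub> free_lift G b w"
    if "v \<in> carrier F" "w \<in> carrier F" for v w
    using h.hom_mult[of v "- w"] h.hom_inv[of w] that by (simp add: a_inv_def a_minus_def)
  have keys: "Poly_Mapping.keys (frag_of p - frag_of q) \<subseteq> carrier M \<times> carrier N"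
    if "p \<in> carrier M \<times> carrier N" "q \<in> carrier M \<times> carrier N" for p q :: "'m \<times> 'n"
    using that keys_diff[of "frag_of p" "frag_of q"] by auto
  have "balance_relations A M N \<subseteq> kernel F (add_monoid G) (free_lift G b)"
  proof
    fix r assume r: "r \<in> balance_relations A M N"
    have cancel: "g \<oplus>\<^bsub>G\<^esub> g' \<ominus>\<^bsub>G\<^esub> g \<ominus>\<^bsub>G\<^esub> g' = \<zero>\<^bsub>G\<^esub>"
      if "g \<in> carrier G" "g' \<in> carrier G" for g g'
      using that by (simp add: a_minus_def G.a_ac G.r_neg G.r_neg2)
    have cancel': "g \<ominus>\<^bsub>G\<^esub> g = \<zero>\<^bsub>G\<^esub>" if "g \<in> carrier G" for g
      using that by (simp add: a_minus_def G.r_neg)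
    from r have "free_lift G b r = \<zero>\<^bsub>G\<^esub>"
      unfolding balance_relations_def
      by (auto simp: hdiff keys fr bD cancel cancel' M.ract_closed N.lact_closed)
    then show "r \<in> kernel F (add_monoid G) (free_lift G b)"
      using r subsetD[OF balance_relations_carrier r] by (simp add: kernel_def)
  qed
  then have ker: "H \<subseteq> kernel F (add_monoid G) (free_lift G b)"
    unfolding tensor_kernel_def by (intro h.generate_subgroup_incl h.subgroup_kernel)
  have "free_lift G b v = free_lift G b u" if v: "v \<in> cls u" for v
  proof -
    obtain k where k: "k \<in> H" "v = k + u" using v by (auto simp: r_coset_def)
    then have "free_lift G b k = \<zero>\<^bsub>G\<^esub>" "k \<in> carrier F" using ker by (auto simp: kernel_def)
    then show ?thesis using h.hom_mult[of k u] h.hom_closed[of u] u k by simp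
  qed
  moreover have "u \<in> cls u"
    using group.rcos_self[OF _ u tensor_kernel_subgroup] by simp
  ultimately have "free_lift G b ` cls u = {free_lift G b u}" by blast
  then show ?thesis by (simp add: tensor_lift_def free_lift_def)
qed

lemma tensor_lift_pure:
  assumes "abelian_group G" "balanced A M N G b" "x \<in> carrier M" "y \<in> carrier N"
  shows "tensor_lift G b (pure_tensor A M N x y) = b x y"
  using assms balancedD(1)[OF assms(2)]
  by (simp add: pure_tensor_def tensor_lift_cls free_lift_frag_of)

lemma tensor_lift_additive:
  assumes G: "abelian_group G" and b: "balanced A M N G b"
  shows "additive_map T G (tensor_lift G b)"
proof -
  interpret h: group_hom F "add_monoid G" "free_lift G b"
    by (rule free_lift_hom[OF G]) (rule balancedD(1)[OF b])
  have "u + v \<in> carrier F" if "u \<in> carrier F" "v \<in> carrier F" for u v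
    using that keys_add[of u v] by auto
  then show ?thesis
    using h.hom_closed h.hom_mult
    by (auto simp: additive_map_def carrier_tensor_prod add_tensor_prod tensor_lift_cls[OF G b]
        simp del: carrier_free_Abelian_group_iff)
qed

lemma tensor_maps_eqI:
  assumes "additive_map T G f" "additive_map T G g"
    and "\<And>x y. x \<in> carrier M \<Longrightarrow> y \<in> carrier N \<Longrightarrow>
           f (pure_tensor A M N x y) = g (pure_tensor A M N x y)"
    and "t \<in> carrier T"
  shows "f t = g t"
  using assms(4)
  by (induction rule: tensor_induct) (simp_all add: assms(3) additive_map_add[OF assms(1)] additive_map_add[OF assms(2)])

end


section \<open>Tensor products of bimodules\<close>

text \<open>
  The part of \<^const>\<open>bimodule\<close> that does not mention the base ring \<open>R\<close>; thus a premise of this form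
  does not introduce a variable that the conclusion fails to determine.
\<close>

definition two_sided_module :: "('a, 'z) ring_scheme \<Rightarrow> ('a, 'm, 'x) bimod_scheme \<Rightarrow> bool" where
  "two_sided_module A M \<longleftrightarrow> left_module A M \<and> right_module A M \<and>
     (\<forall>a\<in>carrier A. \<forall>b\<in>carrier A. \<forall>x\<in>carrier M. (a \<triangleright>\<^bsub>M\<^esub> x) \<triangleleft>\<^bsub>M\<^esub> b = a \<triangleright>\<^bsub>M\<^esub> (x \<triangleleft>\<^bsub>M\<^esub> b))"

lemma two_sidedD:
  assumes "two_sided_module A M"
  shows "left_module A M" "right_module A M"
    and "a \<in> carrier A \<Longrightarrow> b \<in> carrier A \<Longrightarrow> x \<in> carrier M \<Longrightarrow> (a \<triangleright>\<^bsub>M\<^esub> x) \<triangleleft>\<^bsub>M\<^esub> b = a \<triangleright>\<^bsub>M\<^esub> (x \<triangleleft>\<^bsub>M\<^esub> b)"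
  using assms by (auto simp: two_sided_module_def)

lemma bimodule_two_sided: "bimodule R A M \<Longrightarrow> two_sided_module A M"
  by (simp add: two_sided_module_def bimodule_def bimodule_axioms_def)

lemma left_module_group: "left_module A M \<Longrightarrow> abelian_group M"
  by (simp add: left_module_def)

lemma right_module_group: "right_module A M \<Longrightarrow> abelian_group M"
  by (simp add: right_module_def)

lemma balanced_precomp:
  assumes "balanced A M' N' G b" "right_linear A M M' f" "left_linear A N N' g"
  shows "balanced A M N G (\<lambda>x y. b (f x) (g y))"
proof -
  note b = balancedD[OF assms(1)]
  note f = right_linear_additive[OF assms(2)] and g = left_linear_additive[OF assms(3)]
  note fg = additive_map_closed[OF f] additive_map_closed[OF g]
    additive_map_add[OF f] additive_map_add[OF g]
  show ?thesis
    using assms(2,3) by (intro balancedI) (simp_all add: b fg right_linear_def left_linear_def)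
qed

lemma pure_tensor_closed:
  assumes "right_module A M" "left_module A N" "x \<in> carrier M" "y \<in> carrier N"
  shows "pure_tensor A M N x y \<in> carrier (tensor_prod A M N)"
  by (rule balancedD(1)[OF pure_tensor_balanced[OF assms(1,2)] assms(3,4)])

lemma pure_tensor_additive_left:
  assumes "right_module A M" "left_module A N" "y \<in> carrier N"
  shows "additive_map M (tensor_prod A M N) (\<lambda>x. pure_tensor A M N x y)"
  using pure_tensor_balanced[OF assms(1,2)] assms(3) by (simp add: balanced_def)

lemma pure_tensor_additive_right:
  assumes "right_module A M" "left_module A N" "x \<in> carrier M"
  shows "additive_map N (tensor_prod A M N) (pure_tensor A M N x)"
  using pure_tensor_balanced[OF assms(1,2)] assms(3) by (simp add: balanced_def)

lemma pure_tensor_swap: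
  assumes "right_module A M" "left_module A N" "x \<in> carrier M" "a \<in> carrier A" "y \<in> carrier N"
  shows "pure_tensor A M N (x \<triangleleft>\<^bsub>M\<^esub> a) y = pure_tensor A M N x (a \<triangleright>\<^bsub>N\<^esub> y)"
  by (rule balancedD(4)[OF pure_tensor_balanced[OF assms(1,2)] assms(3-5)])

lemma additive_map_pointwise_add:
  assumes "abelian_group N" "additive_map M N f" "additive_map M N g"
  shows "additive_map M N (\<lambda>x. f x \<oplus>\<^bsub>N\<^esub> g x)"
proof -
  interpret N: abelian_group N by fact
  show ?thesis
    using assms(2,3) by (auto simp: additive_map_def Pi_iff N.a_ac)
qed

lemma lact_additive: "left_module A M \<Longrightarrow> a \<in> carrier A \<Longrightarrow> additive_map M M (lact M a)"
  by (simp add: additive_map_def left_module.lact_closed left_module.lact_distr)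

lemma ract_additive: "right_module A M \<Longrightarrow> a \<in> carrier A \<Longrightarrow> additive_map M M (\<lambda>x. x \<triangleleft>\<^bsub>M\<^esub> a)"
  by (simp add: additive_map_def right_module.ract_closed right_module.ract_distr)

lemma lact_right_linear:
  "two_sided_module A M \<Longrightarrow> a \<in> carrier A \<Longrightarrow> right_linear A M M (lact M a)"
  using lact_additive[of A M a] by (simp add: right_linear_def two_sidedD)

lemma ract_left_linear:
  "two_sided_module A M \<Longrightarrow> a \<in> carrier A \<Longrightarrow> left_linear A M M (\<lambda>x. x \<triangleleft>\<^bsub>M\<^esub> a)"
  using ract_additive[of A M a] by (simp add: left_linear_def two_sidedD)

text \<open>
  The actions on a tensor product are defined by lifts into the bare group \<^const>\<open>tensor_group\<close>.  Its
  record type differs from that of \<^const>\<open>tensor_prod\<close>, so the universal property has to be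
  transferred along the coincidence of carrier, addition and zero.
\<close>

lemma tensor_lift_tensor_group:
  assumes M: "right_module A M" and N: "left_module A N"
    and b: "balanced A M N (tensor_prod A M N) b"
  shows "additive_map (tensor_prod A M N) (tensor_prod A M N) (tensor_lift (tensor_group A M N) b)"
    and "x \<in> carrier M \<Longrightarrow> y \<in> carrier N \<Longrightarrow>
           tensor_lift (tensor_group A M N) b (pure_tensor A M N x y) = b x y"
proof -
  let ?T = "tensor_prod A M N" and ?G = "tensor_group A M N"
  have eq: "carrier ?G = carrier ?T" "add ?G = add ?T" "zero ?G = zero ?T"
    by (simp_all add: tensor_prod_def Let_def)
  have "abelian_group ?G"
    using abelian_groupE[OF abelian_group_tensor_prod[OF M N]]
    by (intro abelian_groupI) (simp_all add: eq)
  moreover have "balanced A M N ?G b"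
    using b by (simp add: balanced_def additive_map_def eq)
  ultimately have G: "abelian_group ?G" "balanced A M N ?G b" by simp_all
  show "additive_map ?T ?T (tensor_lift ?G b)"
    using tensor_lift_additive[OF M N G] by (simp add: additive_map_def eq)
  show "x \<in> carrier M \<Longrightarrow> y \<in> carrier N \<Longrightarrow> tensor_lift ?G b (pure_tensor A M N x y) = b x y"
    by (rule tensor_lift_pure[OF M N G])
qed

lemma
  assumes M: "two_sided_module A M" and N: "left_module A N" and a: "a \<in> carrier A"
  shows lact_tensor_additive:
      "additive_map (tensor_prod A M N) (tensor_prod A M N) (lact (tensor_prod A M N) a)"
    and lact_pure_tensor: "x \<in> carrier M \<Longrightarrow> y \<in> carrier N \<Longrightarrow>
      a \<triangleright>\<^bsub>tensor_prod A M N\<^esub> pure_tensor A M N x y = pure_tensor A M N (a \<triangleright>\<^bsub>M\<^esub> x) y"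
proof -
  have lact: "lact (tensor_prod A M N) a =
      tensor_lift (tensor_group A M N) (\<lambda>x y. pure_tensor A M N (a \<triangleright>\<^bsub>M\<^esub> x) y)"
    by (simp add: tensor_prod_def Let_def)
  note M' = two_sidedD(2)[OF M]
  have b: "balanced A M N (tensor_prod A M N) (\<lambda>x y. pure_tensor A M N (a \<triangleright>\<^bsub>M\<^esub> x) y)"
    using balanced_precomp[OF pure_tensor_balanced[OF M' N] lact_right_linear[OF M a] left_linear_id] .
  show "additive_map (tensor_prod A M N) (tensor_prod A M N) (lact (tensor_prod A M N) a)"
    unfolding lact by (rule tensor_lift_tensor_group(1)[OF M' N b])
  show "x \<in> carrier M \<Longrightarrow> y \<in> carrier N \<Longrightarrow>
      a \<triangleright>\<^bsub>tensor_prod A M N\<^esub> pure_tensor A M N x y = pure_tensor A M N (a \<triangleright>\<^bsub>M\<^esub> x) y"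
    unfolding lact by (rule tensor_lift_tensor_group(2)[OF M' N b])
qed

lemma
  assumes M: "right_module A M" and N: "two_sided_module A N" and a: "a \<in> carrier A"
  shows ract_tensor_additive:
      "additive_map (tensor_prod A M N) (tensor_prod A M N) (\<lambda>t. t \<triangleleft>\<^bsub>tensor_prod A M N\<^esub> a)"
    and ract_pure_tensor: "x \<in> carrier M \<Longrightarrow> y \<in> carrier N \<Longrightarrow>
      pure_tensor A M N x y \<triangleleft>\<^bsub>tensor_prod A M N\<^esub> a = pure_tensor A M N x (y \<triangleleft>\<^bsub>N\<^esub> a)"
proof -
  have ract: "(\<lambda>t. t \<triangleleft>\<^bsub>tensor_prod A M N\<^esub> a) =
      tensor_lift (tensor_group A M N) (\<lambda>x y. pure_tensor A M N x (y \<triangleleft>\<^bsub>N\<^esub> a))"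
    by (simp add: tensor_prod_def Let_def)
  note N' = two_sidedD(1)[OF N]
  have b: "balanced A M N (tensor_prod A M N) (\<lambda>x y. pure_tensor A M N x (y \<triangleleft>\<^bsub>N\<^esub> a))"
    using balanced_precomp[OF pure_tensor_balanced[OF M N'] right_linear_id ract_left_linear[OF N a]] .
  show "additive_map (tensor_prod A M N) (tensor_prod A M N) (\<lambda>t. t \<triangleleft>\<^bsub>tensor_prod A M N\<^esub> a)"
    unfolding ract by (rule tensor_lift_tensor_group(1)[OF M N' b])
  show "x \<in> carrier M \<Longrightarrow> y \<in> carrier N \<Longrightarrow>
      pure_tensor A M N x y \<triangleleft>\<^bsub>tensor_prod A M N\<^esub> a = pure_tensor A M N x (y \<triangleleft>\<^bsub>N\<^esub> a)"
    using tensor_lift_tensor_group(2)[OF M N' b] fun_cong[OF ract] by simp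
qed

lemma left_module_tensor_prod:
  assumes M: "two_sided_module A M" and N: "left_module A N"
  shows "left_module A (tensor_prod A M N)"
proof -
  let ?T = "tensor_prod A M N"
  interpret A: ring A using M by (simp add: two_sided_module_def left_module_def)
  interpret M: left_module A M by (rule two_sidedD(1)[OF M])
  note M' = two_sidedD(2)[OF M]
  note G = abelian_group_tensor_prod[OF M' N]
  note eqI = tensor_maps_eqI[OF M' N]
  note simps = lact_pure_tensor[OF M N] additive_map_add[OF pure_tensor_additive_left[OF M' N]]
  note additive = lact_tensor_additive[OF M N]
  show ?thesis
  proof (intro left_module.intro left_module_axioms.intro G A.ring_axioms)
    fix a t assume a: "a \<in> carrier A" and t: "t \<in> carrier ?T"
    show "a \<triangleright>\<^bsub>?T\<^esub> t \<in> carrier ?T" by (rule additive_map_closed[OF additive[OF a] t])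
    {
      fix s assume "s \<in> carrier ?T"
      with a t show "a \<triangleright>\<^bsub>?T\<^esub> (t \<oplus>\<^bsub>?T\<^esub> s) = a \<triangleright>\<^bsub>?T\<^esub> t \<oplus>\<^bsub>?T\<^esub> a \<triangleright>\<^bsub>?T\<^esub> s"
        by (rule additive_map_add[OF additive])
    }
    fix b assume b: "b \<in> carrier A"
    show "(a \<oplus>\<^bsub>A\<^esub> b) \<triangleright>\<^bsub>?T\<^esub> t = a \<triangleright>\<^bsub>?T\<^esub> t \<oplus>\<^bsub>?T\<^esub> b \<triangleright>\<^bsub>?T\<^esub> t"
      by (rule eqI[OF additive[OF A.a_closed[OF a b]]
            additive_map_pointwise_add[OF G additive[OF a] additive[OF b]] _ t])
        (simp add: a b simps M.lact_distr_scalar M.lact_closed)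
    show "(a \<otimes>\<^bsub>A\<^esub> b) \<triangleright>\<^bsub>?T\<^esub> t = a \<triangleright>\<^bsub>?T\<^esub> (b \<triangleright>\<^bsub>?T\<^esub> t)"
      by (rule eqI[OF additive[OF A.m_closed[OF a b]]
            additive_map_comp[OF additive[OF b] additive[OF a]] _ t])
        (simp add: a b simps M.lact_assoc M.lact_closed)
  next
    fix t assume t: "t \<in> carrier ?T"
    show "\<one>\<^bsub>A\<^esub> \<triangleright>\<^bsub>?T\<^esub> t = t"
      by (rule eqI[OF additive[OF A.one_closed] additive_map_id _ t]) (simp add: simps M.lact_one)
  qed
qed

lemma right_module_tensor_prod:
  assumes M: "right_module A M" and N: "two_sided_module A N"
  shows "right_module A (tensor_prod A M N)"
proof -
  let ?T = "tensor_prod A M N"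
  interpret A: ring A using N by (simp add: two_sided_module_def left_module_def)
  interpret N: right_module A N by (rule two_sidedD(2)[OF N])
  note N' = two_sidedD(1)[OF N]
  note G = abelian_group_tensor_prod[OF M N']
  note eqI = tensor_maps_eqI[OF M N']
  note simps = ract_pure_tensor[OF M N] additive_map_add[OF pure_tensor_additive_right[OF M N']]
  note additive = ract_tensor_additive[OF M N]
  show ?thesis
  proof (intro right_module.intro right_module_axioms.intro G A.ring_axioms)
    fix a t assume a: "a \<in> carrier A" and t: "t \<in> carrier ?T"
    show "t \<triangleleft>\<^bsub>?T\<^esub> a \<in> carrier ?T" by (rule additive_map_closed[OF additive[OF a] t])
    {
      fix s assume "s \<in> carrier ?T"
      with a t show "(t \<oplus>\<^bsub>?T\<^esub> s) \<triangleleft>\<^bsub>?T\<^esub> a = t \<triangleleft>\<^bsub>?T\<^esub> a \<oplus>\<^bsub>?T\<^esub> s \<triangleleft>\<^bsub>?T\<^esub> a"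
        by (rule additive_map_add[OF additive])
    }
    fix b assume b: "b \<in> carrier A"
    show "t \<triangleleft>\<^bsub>?T\<^esub> (a \<oplus>\<^bsub>A\<^esub> b) = t \<triangleleft>\<^bsub>?T\<^esub> a \<oplus>\<^bsub>?T\<^esub> t \<triangleleft>\<^bsub>?T\<^esub> b"
      by (rule eqI[OF additive[OF A.a_closed[OF a b]]
            additive_map_pointwise_add[OF G additive[OF a] additive[OF b]] _ t])
        (simp add: a b simps N.ract_distr_scalar N.ract_closed)
    show "t \<triangleleft>\<^bsub>?T\<^esub> (a \<otimes>\<^bsub>A\<^esub> b) = (t \<triangleleft>\<^bsub>?T\<^esub> a) \<triangleleft>\<^bsub>?T\<^esub> b"
      by (rule eqI[OF additive[OF A.m_closed[OF a b]]
            additive_map_comp[OF additive[OF a] additive[OF b]] _ t])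
        (simp add: a b simps N.ract_assoc N.ract_closed)
  next
    fix t assume t: "t \<in> carrier ?T"
    show "t \<triangleleft>\<^bsub>?T\<^esub> \<one>\<^bsub>A\<^esub> = t"
      by (rule eqI[OF additive[OF A.one_closed] additive_map_id _ t]) (simp add: simps N.ract_one)
  qed
qed


section \<open>Functoriality of the tensor product\<close>

lemma
  assumes M: "right_module A M" "left_module A N" and M': "right_module A M'" "left_module A N'"
    and f: "right_linear A M M' f" and g: "left_linear A N N' g"
  shows tensor_map_additive:
      "additive_map (tensor_prod A M N) (tensor_prod A M' N') (tensor_map A M' N' f g)"
    and tensor_map_pure: "x \<in> carrier M \<Longrightarrow> y \<in> carrier N \<Longrightarrow>
      tensor_map A M' N' f g (pure_tensor A M N x y) = pure_tensor A M' N' (f x) (g y)"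
proof -
  note b = balanced_precomp[OF pure_tensor_balanced[OF M'] f g]
  note G = abelian_group_tensor_prod[OF M']
  show "additive_map (tensor_prod A M N) (tensor_prod A M' N') (tensor_map A M' N' f g)"
    unfolding tensor_map_def by (rule tensor_lift_additive[OF M G b])
  show "x \<in> carrier M \<Longrightarrow> y \<in> carrier N \<Longrightarrow>
      tensor_map A M' N' f g (pure_tensor A M N x y) = pure_tensor A M' N' (f x) (g y)"
    unfolding tensor_map_def by (rule tensor_lift_pure[OF M G b])
qed

lemma tensor_map_cong:
  assumes M: "right_module A M" "left_module A N" and M': "right_module A M'" "left_module A N'"
    and f: "right_linear A M M' f" "right_linear A M M' f'"
    and g: "left_linear A N N' g" "left_linear A N N' g'"
    and eq: "\<And>x. x \<in> carrier M \<Longrightarrow> f x = f' x" "\<And>y. y \<in> carrier N \<Longrightarrow> g y = g' y"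
    and t: "t \<in> carrier (tensor_prod A M N)"
  shows "tensor_map A M' N' f g t = tensor_map A M' N' f' g' t"
  by (rule tensor_maps_eqI[OF M tensor_map_additive[OF M M' f(1) g(1)]
        tensor_map_additive[OF M M' f(2) g(2)] _ t])
    (simp add: tensor_map_pure[OF M M' f(1) g(1)] tensor_map_pure[OF M M' f(2) g(2)] eq)

lemma tensor_map_id:
  assumes M: "right_module A M" "left_module A N" and t: "t \<in> carrier (tensor_prod A M N)"
  shows "tensor_map A M N (\<lambda>x. x) (\<lambda>y. y) t = t"
  by (rule tensor_maps_eqI[OF M tensor_map_additive[OF M M right_linear_id left_linear_id]
        additive_map_id _ t])
    (simp add: tensor_map_pure[OF M M right_linear_id left_linear_id])

lemma tensor_map_comp:
  assumes M: "right_module A M" "left_module A N" and M': "right_module A M'" "left_module A N'"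
    and M'': "right_module A M''" "left_module A N''"
    and f: "right_linear A M M' f" "right_linear A M' M'' f'"
    and g: "left_linear A N N' g" "left_linear A N' N'' g'"
    and t: "t \<in> carrier (tensor_prod A M N)"
  shows "tensor_map A M'' N'' f' g' (tensor_map A M' N' f g t) =
         tensor_map A M'' N'' (\<lambda>x. f' (f x)) (\<lambda>y. g' (g y)) t"
proof (rule tensor_maps_eqI[OF M _ _ _ t])
  note fg = right_linear_comp[OF f] left_linear_comp[OF g]
  note closed = additive_map_closed[OF right_linear_additive[OF f(1)]]
    additive_map_closed[OF left_linear_additive[OF g(1)]]
  show "additive_map (tensor_prod A M N) (tensor_prod A M'' N'')
      (\<lambda>t. tensor_map A M'' N'' f' g' (tensor_map A M' N' f g t))"
    by (rule additive_map_comp[OF tensor_map_additive[OF M M' f(1) g(1)]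
          tensor_map_additive[OF M' M'' f(2) g(2)]])
  show "additive_map (tensor_prod A M N) (tensor_prod A M'' N'')
      (tensor_map A M'' N'' (\<lambda>x. f' (f x)) (\<lambda>y. g' (g y)))"
    by (rule tensor_map_additive[OF M M'' fg])
  show "tensor_map A M'' N'' f' g' (tensor_map A M' N' f g (pure_tensor A M N x y)) =
      tensor_map A M'' N'' (\<lambda>x. f' (f x)) (\<lambda>y. g' (g y)) (pure_tensor A M N x y)"
    if "x \<in> carrier M" "y \<in> carrier N" for x y
    using that
    by (simp add: tensor_map_pure[OF M M' f(1) g(1)] tensor_map_pure[OF M' M'' f(2) g(2)]
        tensor_map_pure[OF M M'' fg] closed)
qed

lemma tensor_map_left_linear:
  assumes M: "two_sided_module A M" "left_module A N" and M': "two_sided_module A M'" "left_module A N'"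
    and f: "right_linear A M M' f" "left_linear A M M' f" and g: "left_linear A N N' g"
  shows "left_linear A (tensor_prod A M N) (tensor_prod A M' N') (tensor_map A M' N' f g)"
  unfolding left_linear_def
proof (intro conjI ballI)
  note r = two_sidedD(2)[OF M(1)] M(2) two_sidedD(2)[OF M'(1)] M'(2) f(1) g
  note fg = additive_map_closed[OF left_linear_additive[OF f(2)]]
    additive_map_closed[OF left_linear_additive[OF g]]
  show additive: "additive_map (tensor_prod A M N) (tensor_prod A M' N') (tensor_map A M' N' f g)"
    by (rule tensor_map_additive[OF r])
  fix a t assume a: "a \<in> carrier A" and t: "t \<in> carrier (tensor_prod A M N)"
  show "tensor_map A M' N' f g (a \<triangleright>\<^bsub>tensor_prod A M N\<^esub> t) =
      a \<triangleright>\<^bsub>tensor_prod A M' N'\<^esub> tensor_map A M' N' f g t"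
  proof (rule tensor_maps_eqI[OF r(1,2) _ _ _ t])
    fix x y assume xy: "x \<in> carrier M" "y \<in> carrier N"
    moreover have "a \<triangleright>\<^bsub>M\<^esub> x \<in> carrier M"
      using a xy two_sidedD(1)[OF M(1)] by (simp add: left_module.lact_closed)
    ultimately show "tensor_map A M' N' f g (a \<triangleright>\<^bsub>tensor_prod A M N\<^esub> pure_tensor A M N x y) =
        a \<triangleright>\<^bsub>tensor_prod A M' N'\<^esub> tensor_map A M' N' f g (pure_tensor A M N x y)"
      using a f(2) by (simp add: tensor_map_pure[OF r] lact_pure_tensor[OF M] lact_pure_tensor[OF M']
          fg left_linear_def)
  qed (rule additive_map_comp[OF lact_tensor_additive[OF M a] additive]
      additive_map_comp[OF additive lact_tensor_additive[OF M' a]])+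
qed

lemma tensor_map_right_linear:
  assumes M: "right_module A M" "two_sided_module A N" and M': "right_module A M'" "two_sided_module A N'"
    and f: "right_linear A M M' f" and g: "left_linear A N N' g" "right_linear A N N' g"
  shows "right_linear A (tensor_prod A M N) (tensor_prod A M' N') (tensor_map A M' N' f g)"
  unfolding right_linear_def
proof (intro conjI ballI)
  note r = M(1) two_sidedD(1)[OF M(2)] M'(1) two_sidedD(1)[OF M'(2)] f g(1)
  note fg = additive_map_closed[OF right_linear_additive[OF f]]
    additive_map_closed[OF right_linear_additive[OF g(2)]]
  show additive: "additive_map (tensor_prod A M N) (tensor_prod A M' N') (tensor_map A M' N' f g)"
    by (rule tensor_map_additive[OF r])
  fix a t assume a: "a \<in> carrier A" and t: "t \<in> carrier (tensor_prod A M N)"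
  show "tensor_map A M' N' f g (t \<triangleleft>\<^bsub>tensor_prod A M N\<^esub> a) =
      tensor_map A M' N' f g t \<triangleleft>\<^bsub>tensor_prod A M' N'\<^esub> a"
  proof (rule tensor_maps_eqI[OF r(1,2) _ _ _ t])
    fix x y assume xy: "x \<in> carrier M" "y \<in> carrier N"
    moreover have "y \<triangleleft>\<^bsub>N\<^esub> a \<in> carrier N"
      using a xy two_sidedD(2)[OF M(2)] by (simp add: right_module.ract_closed)
    ultimately show "tensor_map A M' N' f g (pure_tensor A M N x y \<triangleleft>\<^bsub>tensor_prod A M N\<^esub> a) =
        tensor_map A M' N' f g (pure_tensor A M N x y) \<triangleleft>\<^bsub>tensor_prod A M' N'\<^esub> a"
      using a g(2) by (simp add: tensor_map_pure[OF r] ract_pure_tensor[OF M] ract_pure_tensor[OF M']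
          fg right_linear_def)
  qed (rule additive_map_comp[OF ract_tensor_additive[OF M a] additive]
      additive_map_comp[OF additive ract_tensor_additive[OF M' a]])+
qed

text \<open>
  Lifting is natural; this relates the counit of a subcomodule to the counit of the whole coring.
\<close>

lemma tensor_lift_tensor_map:
  assumes M: "right_module A M" "left_module A N" and M': "right_module A M'" "left_module A N'"
    and f: "right_linear A M M' f" and g: "left_linear A N N' g"
    and G: "abelian_group G" "balanced A M' N' G b"
    and t: "t \<in> carrier (tensor_prod A M N)"
  shows "tensor_lift G b (tensor_map A M' N' f g t) = tensor_lift G (\<lambda>x y. b (f x) (g y)) t"
proof (rule tensor_maps_eqI[OF M _ _ _ t])
  note fg = additive_map_closed[OF right_linear_additive[OF f]]
    additive_map_closed[OF left_linear_additive[OF g]]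
  note b = balanced_precomp[OF G(2) f g]
  show "additive_map (tensor_prod A M N) G (\<lambda>t. tensor_lift G b (tensor_map A M' N' f g t))"
    by (rule additive_map_comp[OF tensor_map_additive[OF M M' f g] tensor_lift_additive[OF M' G]])
  show "additive_map (tensor_prod A M N) G (tensor_lift G (\<lambda>x y. b (f x) (g y)))"
    by (rule tensor_lift_additive[OF M G(1) b])
  show "tensor_lift G b (tensor_map A M' N' f g (pure_tensor A M N x y)) =
      tensor_lift G (\<lambda>x y. b (f x) (g y)) (pure_tensor A M N x y)"
    if "x \<in> carrier M" "y \<in> carrier N" for x y
    using that by (simp add: tensor_map_pure[OF M M' f g] tensor_lift_pure[OF M' G]
        tensor_lift_pure[OF M G(1) b] fg)
qed


section \<open>Associativity of the tensor product\<close>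

context
  fixes A :: "('a, 'z) ring_scheme" and M :: "('a, 'm, 'x) bimod_scheme"
    and N :: "('a, 'n, 'y) bimod_scheme" and P :: "('a, 'p, 'w) bimod_scheme"
  assumes M: "right_module A M" and N: "two_sided_module A N" and P: "left_module A P"
begin

private abbreviation (input) "MN \<equiv> tensor_prod A M N"
private abbreviation (input) "NP \<equiv> tensor_prod A N P"

private lemmas NL = two_sidedD(1)[OF N]
private lemmas NR = two_sidedD(2)[OF N]
private lemmas MN = right_module_tensor_prod[OF M N]
private lemmas NP = left_module_tensor_prod[OF N P]

text \<open>
  The map \<^const>\<open>tensor_assoc\<close> is a lift of lifts: the inner one is balanced for fixed \<open>x\<close>, and the
  outer one is balanced because both sides of each law are additive in the inner tensor and may thus
  be compared on pure tensors.
\<close>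

lemma tensor_assoc_balanced_inner:
  assumes x: "x \<in> carrier M"
  shows "balanced A N P (tensor_prod A MN P) (\<lambda>y z. pure_tensor A MN P (pure_tensor A M N x y) z)"
  using x
  by (intro balancedI)
    (simp_all add: pure_tensor_closed[OF MN P] pure_tensor_closed[OF M NL]
      additive_map_add[OF pure_tensor_additive_left[OF MN P]]
      additive_map_add[OF pure_tensor_additive_right[OF MN P]]
      additive_map_add[OF pure_tensor_additive_right[OF M NL]]
      ract_pure_tensor[OF M N, symmetric] pure_tensor_swap[OF MN P])

lemma tensor_assoc_balanced_outer:
  "balanced A M NP (tensor_prod A MN P)
     (\<lambda>x. tensor_lift (tensor_prod A MN P) (\<lambda>y z. pure_tensor A MN P (pure_tensor A M N x y) z))"
    (is "balanced _ _ _ ?G ?b")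
proof (rule balancedI)
  note G = abelian_group_tensor_prod[OF MN P]
  have additive: "additive_map NP ?G (?b x)" if "x \<in> carrier M" for x
    by (rule tensor_lift_additive[OF NR P G tensor_assoc_balanced_inner[OF that]])
  have pure: "?b x (pure_tensor A N P y z) = pure_tensor A MN P (pure_tensor A M N x y) z"
    if "x \<in> carrier M" "y \<in> carrier N" "z \<in> carrier P" for x y z
    by (rule tensor_lift_pure[OF NR P G tensor_assoc_balanced_inner[OF that(1)] that(2,3)])
  note eqI = tensor_maps_eqI[OF NR P]
  fix x t assume x: "x \<in> carrier M" and t: "t \<in> carrier NP"
  show "?b x t \<in> carrier ?G"
    by (rule additive_map_closed[OF additive[OF x] t])
  show "?b x (t \<oplus>\<^bsub>NP\<^esub> t') = ?b x t \<oplus>\<^bsub>?G\<^esub> ?b x t'" if "t' \<in> carrier NP" for t'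
    by (rule additive_map_add[OF additive[OF x] t that])
  show "?b (x \<oplus>\<^bsub>M\<^esub> x') t = ?b x t \<oplus>\<^bsub>?G\<^esub> ?b x' t" if x': "x' \<in> carrier M" for x'
  proof (rule eqI[OF _ _ _ t])
    have xx': "x \<oplus>\<^bsub>M\<^esub> x' \<in> carrier M"
      using abelian_groupE(1)[OF right_module_group[OF M]] x x' by blast
    show "additive_map NP ?G (?b (x \<oplus>\<^bsub>M\<^esub> x'))" by (rule additive[OF xx'])
    show "additive_map NP ?G (\<lambda>t. ?b x t \<oplus>\<^bsub>?G\<^esub> ?b x' t)"
      by (rule additive_map_pointwise_add[OF G additive[OF x] additive[OF x']])
    show "?b (x \<oplus>\<^bsub>M\<^esub> x') (pure_tensor A N P y z) =
        ?b x (pure_tensor A N P y z) \<oplus>\<^bsub>?G\<^esub> ?b x' (pure_tensor A N P y z)"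
      if "y \<in> carrier N" "z \<in> carrier P" for y z
      using that x x' xx'
      by (simp add: pure additive_map_add[OF pure_tensor_additive_left[OF M NL]]
          additive_map_add[OF pure_tensor_additive_left[OF MN P]] pure_tensor_closed[OF M NL])
  qed
  show "?b (x \<triangleleft>\<^bsub>M\<^esub> a) t = ?b x (a \<triangleright>\<^bsub>NP\<^esub> t)" if a: "a \<in> carrier A" for a
  proof (rule eqI[OF _ _ _ t])
    have xa: "x \<triangleleft>\<^bsub>M\<^esub> a \<in> carrier M" using right_module.ract_closed[OF M a x] .
    show "additive_map NP ?G (?b (x \<triangleleft>\<^bsub>M\<^esub> a))" by (rule additive[OF xa])
    show "additive_map NP ?G (\<lambda>t. ?b x (a \<triangleright>\<^bsub>NP\<^esub> t))"
      by (rule additive_map_comp[OF lact_additive[OF NP a] additive[OF x]])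
    show "?b (x \<triangleleft>\<^bsub>M\<^esub> a) (pure_tensor A N P y z) = ?b x (a \<triangleright>\<^bsub>NP\<^esub> pure_tensor A N P y z)"
      if "y \<in> carrier N" "z \<in> carrier P" for y z
      using that x xa a left_module.lact_closed[OF NL a that(1)]
      by (simp add: pure lact_pure_tensor[OF N P] pure_tensor_swap[OF M NL])
  qed
qed

lemma tensor_assoc_additive:
  "additive_map (tensor_prod A M NP) (tensor_prod A MN P) (tensor_assoc A M N P)"
  unfolding tensor_assoc_def Let_def
  by (rule tensor_lift_additive[OF M NP abelian_group_tensor_prod[OF MN P] tensor_assoc_balanced_outer])

lemma tensor_assoc_pure:
  assumes "x \<in> carrier M" "y \<in> carrier N" "z \<in> carrier P"
  shows "tensor_assoc A M N P (pure_tensor A M NP x (pure_tensor A N P y z)) =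
         pure_tensor A MN P (pure_tensor A M N x y) z"
  unfolding tensor_assoc_def Let_def
  using assms
  by (simp add: tensor_lift_pure[OF M NP abelian_group_tensor_prod[OF MN P] tensor_assoc_balanced_outer]
      pure_tensor_closed[OF NR P]
      tensor_lift_pure[OF NR P abelian_group_tensor_prod[OF MN P] tensor_assoc_balanced_inner])

lemma right_nested_maps_eqI:
  assumes f: "additive_map (tensor_prod A M NP) G f" and g: "additive_map (tensor_prod A M NP) G g"
    and eq: "\<And>x y z. x \<in> carrier M \<Longrightarrow> y \<in> carrier N \<Longrightarrow> z \<in> carrier P \<Longrightarrow>
       f (pure_tensor A M NP x (pure_tensor A N P y z)) =
       g (pure_tensor A M NP x (pure_tensor A N P y z))"
    and t: "t \<in> carrier (tensor_prod A M NP)"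
  shows "f t = g t"
proof (rule tensor_maps_eqI[OF M NP f g _ t])
  fix x s assume x: "x \<in> carrier M" and s: "s \<in> carrier NP"
  note px = pure_tensor_additive_right[OF M NP x]
  show "f (pure_tensor A M NP x s) = g (pure_tensor A M NP x s)"
    by (rule tensor_maps_eqI[OF NR P additive_map_comp[OF px f] additive_map_comp[OF px g] _ s])
      (rule eq[OF x])
qed

lemma left_nested_maps_eqI:
  assumes f: "additive_map (tensor_prod A MN P) G f" and g: "additive_map (tensor_prod A MN P) G g"
    and eq: "\<And>x y z. x \<in> carrier M \<Longrightarrow> y \<in> carrier N \<Longrightarrow> z \<in> carrier P \<Longrightarrow>
       f (pure_tensor A MN P (pure_tensor A M N x y) z) =
       g (pure_tensor A MN P (pure_tensor A M N x y) z)"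
    and t: "t \<in> carrier (tensor_prod A MN P)"
  shows "f t = g t"
proof (rule tensor_maps_eqI[OF MN P f g _ t])
  fix s z assume s: "s \<in> carrier MN" and z: "z \<in> carrier P"
  note pz = pure_tensor_additive_left[OF MN P z]
  show "f (pure_tensor A MN P s z) = g (pure_tensor A MN P s z)"
    by (rule tensor_maps_eqI[OF M NL additive_map_comp[OF pz f] additive_map_comp[OF pz g] _ s])
      (rule eq[OF _ _ z])
qed

private abbreviation (input) "G \<equiv> tensor_prod A M NP"

private abbreviation (input)
  "unassoc t z \<equiv> tensor_lift G (\<lambda>x y. pure_tensor A M NP x (pure_tensor A N P y z)) t"

private lemma unassoc_balanced_inner:
  assumes z: "z \<in> carrier P"
  shows "balanced A M N G (\<lambda>x y. pure_tensor A M NP x (pure_tensor A N P y z))"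
  using z
  by (intro balancedI)
    (simp_all add: pure_tensor_closed[OF M NP] pure_tensor_closed[OF NR P]
      additive_map_add[OF pure_tensor_additive_left[OF M NP]]
      additive_map_add[OF pure_tensor_additive_right[OF M NP]]
      additive_map_add[OF pure_tensor_additive_left[OF NR P]]
      lact_pure_tensor[OF N P, symmetric] pure_tensor_swap[OF M NP])

private lemma unassoc_balanced: "balanced A MN P G (\<lambda>t z. unassoc t z)"
proof (rule balancedI)
  note G = abelian_group_tensor_prod[OF M NP]
  have additive: "additive_map MN G (\<lambda>t. unassoc t z)" if "z \<in> carrier P" for z
    by (rule tensor_lift_additive[OF M NL G unassoc_balanced_inner[OF that]])
  have pure: "unassoc (pure_tensor A M N x y) z = pure_tensor A M NP x (pure_tensor A N P y z)"
    if "x \<in> carrier M" "y \<in> carrier N" "z \<in> carrier P" for x y z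
    by (rule tensor_lift_pure[OF M NL G unassoc_balanced_inner[OF that(3)] that(1,2)])
  fix t z assume t: "t \<in> carrier MN" and z: "z \<in> carrier P"
  show "unassoc t z \<in> carrier G"
    by (rule additive_map_closed[OF additive[OF z] t])
  show "unassoc (t \<oplus>\<^bsub>MN\<^esub> t') z = unassoc t z \<oplus>\<^bsub>G\<^esub> unassoc t' z" if "t' \<in> carrier MN" for t'
    by (rule additive_map_add[OF additive[OF z] t that])
  show "unassoc t (z \<oplus>\<^bsub>P\<^esub> z') = unassoc t z \<oplus>\<^bsub>G\<^esub> unassoc t z'" if z': "z' \<in> carrier P" for z'
  proof -
    have zz': "z \<oplus>\<^bsub>P\<^esub> z' \<in> carrier P"
      using abelian_groupE(1)[OF left_module_group[OF P] z z'] .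
    show ?thesis
      by (rule tensor_maps_eqI[OF M NL additive[OF zz']
            additive_map_pointwise_add[OF G additive[OF z] additive[OF z']] _ t])
        (simp add: pure z z' zz' additive_map_add[OF pure_tensor_additive_right[OF NR P]]
          additive_map_add[OF pure_tensor_additive_right[OF M NP]] pure_tensor_closed[OF NR P])
  qed
  show "unassoc (t \<triangleleft>\<^bsub>MN\<^esub> a) z = unassoc t (a \<triangleright>\<^bsub>P\<^esub> z)" if a: "a \<in> carrier A" for a
  proof -
    have az: "a \<triangleright>\<^bsub>P\<^esub> z \<in> carrier P" using left_module.lact_closed[OF P a z] .
    show ?thesis
      by (rule tensor_maps_eqI[OF M NL additive_map_comp[OF ract_additive[OF MN a] additive[OF z]]
            additive[OF az] _ t])
        (simp add: pure z a az ract_pure_tensor[OF M N] right_module.ract_closed[OF NR a]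
          pure_tensor_swap[OF NR P])
  qed
qed

text \<open>
  The inverse is the lift of \<open>(x \<otimes> y, z) \<mapsto> x \<otimes> (y \<otimes> z)\<close>; both composites fix all pure tensors.
\<close>

lemma tensor_assoc_bij_betw:
  "bij_betw (tensor_assoc A M N P) (carrier (tensor_prod A M NP)) (carrier (tensor_prod A MN P))"
proof -
  let ?\<gamma> = "tensor_lift G (\<lambda>t z. unassoc t z)"
  note G = abelian_group_tensor_prod[OF M NP]
  have additive: "additive_map (tensor_prod A MN P) G ?\<gamma>"
    by (rule tensor_lift_additive[OF MN P G unassoc_balanced])
  have pure: "?\<gamma> (pure_tensor A MN P (pure_tensor A M N x y) z) =
      pure_tensor A M NP x (pure_tensor A N P y z)"
    if "x \<in> carrier M" "y \<in> carrier N" "z \<in> carrier P" for x y z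
    using that
    by (simp add: tensor_lift_pure[OF MN P G unassoc_balanced] pure_tensor_closed[OF M NL]
        tensor_lift_pure[OF M NL G unassoc_balanced_inner])
  note assoc = tensor_assoc_additive tensor_assoc_pure
  have "?\<gamma> (tensor_assoc A M N P t) = t" if "t \<in> carrier (tensor_prod A M NP)" for t
    by (rule right_nested_maps_eqI[OF additive_map_comp[OF assoc(1) additive]
          additive_map_id _ that])
      (simp add: pure assoc(2))
  moreover have "tensor_assoc A M N P (?\<gamma> t) = t" if "t \<in> carrier (tensor_prod A MN P)" for t
    by (rule left_nested_maps_eqI[OF additive_map_comp[OF additive assoc(1)]
          additive_map_id _ that])
      (simp add: pure assoc(2))
  ultimately show ?thesis
    using additive_map_closed[OF additive] additive_map_closed[OF assoc(1)]
    by (intro bij_betw_byWitness[where f' = ?\<gamma>] ballI image_subsetI)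
qed

end

lemma tensor_assoc_natural:
  assumes M: "right_module A M" "two_sided_module A N" "left_module A P"
    and M': "right_module A M'" "two_sided_module A N'" "left_module A P'"
    and f: "right_linear A M M' f" and g: "left_linear A N N' g" "right_linear A N N' g"
    and h: "left_linear A P P' h"
    and t: "t \<in> carrier (tensor_prod A M (tensor_prod A N P))"
  shows "tensor_assoc A M' N' P'
           (tensor_map A M' (tensor_prod A N' P') f (tensor_map A N' P' g h) t) =
         tensor_map A (tensor_prod A M' N') P' (tensor_map A M' N' f g) h (tensor_assoc A M N P t)"
proof -
  note fcl = additive_map_closed[OF right_linear_additive[OF f]]
    and gcl = additive_map_closed[OF left_linear_additive[OF g(1)]]
    and hcl = additive_map_closed[OF left_linear_additive[OF h]]
  note N = two_sidedD(1)[OF M(2)] two_sidedD(2)[OF M(2)]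
    and N' = two_sidedD(1)[OF M'(2)] two_sidedD(2)[OF M'(2)]
  note MN = right_module_tensor_prod[OF M(1,2)] and NP = left_module_tensor_prod[OF M(2,3)]
  note MN' = right_module_tensor_prod[OF M'(1,2)] and NP' = left_module_tensor_prod[OF M'(2,3)]
  note fg = tensor_map_right_linear[OF M(1,2) M'(1,2) f g]
  note gh = tensor_map_left_linear[OF M(2,3) M'(2,3) g(2,1) h]
  note f_gh = M(1) NP M'(1) NP' f gh and fg_h = MN M(3) MN' M'(3) fg h
  show ?thesis
  proof (rule right_nested_maps_eqI[OF M additive_map_comp[OF tensor_map_additive[OF f_gh]
          tensor_assoc_additive[OF M']] additive_map_comp[OF tensor_assoc_additive[OF M]
          tensor_map_additive[OF fg_h]] _ t])
    fix x y z assume xyz: "x \<in> carrier M" "y \<in> carrier N" "z \<in> carrier P"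
    note yz = pure_tensor_closed[OF N(2) M(3) xyz(2,3)] and xy = pure_tensor_closed[OF M(1) N(1) xyz(1,2)]
    show "tensor_assoc A M' N' P' (tensor_map A M' (tensor_prod A N' P') f (tensor_map A N' P' g h)
            (pure_tensor A M (tensor_prod A N P) x (pure_tensor A N P y z))) =
          tensor_map A (tensor_prod A M' N') P' (tensor_map A M' N' f g) h
            (tensor_assoc A M N P (pure_tensor A M (tensor_prod A N P) x (pure_tensor A N P y z)))"
      by (simp add: xyz xy yz fcl gcl hcl tensor_map_pure[OF f_gh] tensor_map_pure[OF fg_h]
          tensor_map_pure[OF N(2) M(3) N'(2) M'(3) g(2) h]
          tensor_map_pure[OF M(1) N(1) M'(1) N'(1) f g(1)]
          tensor_assoc_pure[OF M] tensor_assoc_pure[OF M'])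
  qed
qed


section \<open>Flatness\<close>

text \<open>
  Flatness is tested on modules whose carrier lives in one fixed type.  To apply it to other modules,
  such as submodules of \<open>C\<close> or tensor products, these are moved into that type along an injection.
\<close>

definition transport_module ::
  "('p \<Rightarrow> 'u) \<Rightarrow> ('a, 'p, 'x) bimod_scheme \<Rightarrow> ('a, 'u) bimod" where
  "transport_module e P =
     \<lparr>carrier = e ` carrier P, mult = undefined, one = undefined, zero = e \<zero>\<^bsub>P\<^esub>,
      add = (\<lambda>u v. e (inv_into UNIV e u \<oplus>\<^bsub>P\<^esub> inv_into UNIV e v)),
      lact = (\<lambda>a u. e (a \<triangleright>\<^bsub>P\<^esub> inv_into UNIV e u)), ract = (\<lambda>u a. e (inv_into UNIV e u \<triangleleft>\<^bsub>P\<^esub> a))\<rparr>"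

context
  fixes e :: "'p \<Rightarrow> 'u" and A :: "('a, 'z) ring_scheme" and P :: "('a, 'p, 'x) bimod_scheme"
  assumes e: "inj e"
begin

lemma transport_abelian_group:
  assumes "abelian_group P"
  shows "abelian_group (transport_module e P)"
proof -
  interpret P: abelian_group P by fact
  show ?thesis
  proof (rule abelian_groupI)
    show "\<exists>v\<in>carrier (transport_module e P). v \<oplus>\<^bsub>transport_module e P\<^esub> u = \<zero>\<^bsub>transport_module e P\<^esub>"
      if u: "u \<in> carrier (transport_module e P)" for u
    proof -
      obtain x where x: "u = e x" "x \<in> carrier P" using u by (auto simp: transport_module_def)
      then show ?thesis
        by (intro bexI[of _ "e (\<ominus>\<^bsub>P\<^esub> x)"]) (auto simp: transport_module_def inv_f_f[OF e] P.l_neg)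
    qed
  qed (auto simp: transport_module_def inv_f_f[OF e] P.a_ac)
qed

lemma transport_right_module:
  assumes "right_module A P"
  shows "right_module A (transport_module e P)"
proof -
  interpret A: ring A using assms by (simp add: right_module_def)
  interpret P: right_module A P by fact
  show ?thesis
    by (intro right_module.intro right_module_axioms.intro A.ring_axioms
        transport_abelian_group right_module_group[OF assms])
      (auto simp: transport_module_def inv_f_f[OF e] P.ract_closed P.ract_distr P.ract_distr_scalar
        P.ract_assoc P.ract_one)
qed

lemma transport_left_module:
  assumes "left_module A P"
  shows "left_module A (transport_module e P)"
proof -
  interpret A: ring A using assms by (simp add: left_module_def)
  interpret P: left_module A P by fact
  show ?thesis
    by (intro left_module.intro left_module_axioms.intro A.ring_axioms
        transport_abelian_group left_module_group[OF assms])
      (auto simp: transport_module_def inv_f_f[OF e] P.lact_closed P.lact_distr P.lact_distr_scalar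
        P.lact_assoc P.lact_one)
qed

lemma transport_linear:
  shows "right_linear A P (transport_module e P) e" "right_linear A (transport_module e P) P (inv_into UNIV e)"
    and "left_linear A P (transport_module e P) e" "left_linear A (transport_module e P) P (inv_into UNIV e)"
  by (auto simp: right_linear_def left_linear_def additive_map_def transport_module_def inv_f_f[OF e])

end

text \<open>
  Let \<open>P'\<close> and \<open>Q'\<close> be the copies of \<open>P\<close> and \<open>Q\<close> in the test type and \<open>f'\<close> the copy of \<open>f\<close>.  The
  square formed by \<open>f \<otimes> C\<close>, \<open>f' \<otimes> C\<close> and the two transports commutes, and \<open>P \<otimes> C \<rightarrow> P' \<otimes> C\<close> is
  injective, having a left inverse by functoriality.
\<close>

lemma flat_left_inj_on:
  fixes A :: "('a, 'z) ring_scheme" and C :: "('a, 'c, 'w) bimod_scheme"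
    and P :: "('a, 'p, 'x) bimod_scheme" and Q :: "('a, 'q, 'y) bimod_scheme"
    and eP :: "'p \<Rightarrow> ('a, 'c) test_universe" and eQ :: "'q \<Rightarrow> ('a, 'c) test_universe"
  assumes flat: "flat_left A C" and P: "right_module A P" and Q: "right_module A Q"
    and f: "right_linear A P Q f" "inj_on f (carrier P)" and e: "inj eP" "inj eQ"
  shows "inj_on (tensor_map A Q C f (\<lambda>x. x)) (carrier (tensor_prod A P C))"
proof (rule inj_onI)
  fix s t
  assume s: "s \<in> carrier (tensor_prod A P C)" and t: "t \<in> carrier (tensor_prod A P C)"
    and eq: "tensor_map A Q C f (\<lambda>x. x) s = tensor_map A Q C f (\<lambda>x. x) t"
  define P' where "P' = transport_module eP P"
  define Q' where "Q' = transport_module eQ Q"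
  define f' where "f' = (\<lambda>u. eQ (f (inv_into UNIV eP u)))"
  have C: "left_module A C" using flat by (simp add: flat_left_def)
  have P': "right_module A P'" and Q': "right_module A Q'"
    unfolding P'_def Q'_def using transport_right_module e P Q by blast+
  have eP: "right_linear A P P' eP" "right_linear A P' P (inv_into UNIV eP)"
    and eQ: "right_linear A Q Q' eQ"
    unfolding P'_def Q'_def using transport_linear e by blast+
  note id = left_linear_id[of A C]
  have f': "right_linear A P' Q' f'"
    unfolding f'_def by (rule right_linear_comp[OF right_linear_comp[OF eP(2) f(1)] eQ])
  have "inj_on f' (carrier P')"
    by (intro inj_onI) (auto simp: f'_def P'_def transport_module_def inv_f_f[OF e(1)]
        inj_eq[OF e(2)] inj_on_eq_iff[OF f(2)])
  with flat P' Q' f' have inj: "inj_on (tensor_map A Q' C f' (\<lambda>x. x)) (carrier (tensor_prod A P' C))"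
    by (simp add: flat_left_def)
  define E where "E = tensor_map A P' C eP (\<lambda>x. x)"
  have E: "E u \<in> carrier (tensor_prod A P' C)" if "u \<in> carrier (tensor_prod A P C)" for u
    unfolding E_def by (rule additive_map_closed[OF tensor_map_additive[OF P C P' C eP(1) id] that])
  have "tensor_map A Q' C f' (\<lambda>x. x) (E u) =
      tensor_map A Q' C eQ (\<lambda>x. x) (tensor_map A Q C f (\<lambda>x. x) u)"
    if u: "u \<in> carrier (tensor_prod A P C)" for u
    unfolding E_def tensor_map_comp[OF P C P' C Q' C eP(1) f' id id u]
      tensor_map_comp[OF P C Q C Q' C f(1) eQ id id u]
    by (simp add: f'_def inv_f_f[OF e(1)])
  with eq s t have "tensor_map A Q' C f' (\<lambda>x. x) (E s) = tensor_map A Q' C f' (\<lambda>x. x) (E t)"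
    by simp
  then have "E s = E t" using inj_onD[OF inj] E s t by blast
  moreover have "tensor_map A P C (inv_into UNIV eP) (\<lambda>x. x) (E u) = u"
    if u: "u \<in> carrier (tensor_prod A P C)" for u
    unfolding E_def tensor_map_comp[OF P C P' C P C eP id id u]
    by (simp add: inv_f_f[OF e(1)] tensor_map_id[OF P C u])
  ultimately show "s = t" using s t by metis
qed

lemma flat_right_inj_on:
  fixes A :: "('a, 'z) ring_scheme" and C :: "('a, 'c, 'w) bimod_scheme"
    and P :: "('a, 'p, 'x) bimod_scheme" and Q :: "('a, 'q, 'y) bimod_scheme"
    and eP :: "'p \<Rightarrow> ('a, 'c) test_universe" and eQ :: "'q \<Rightarrow> ('a, 'c) test_universe"
  assumes flat: "flat_right A C" and P: "left_module A P" and Q: "left_module A Q"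
    and f: "left_linear A P Q f" "inj_on f (carrier P)" and e: "inj eP" "inj eQ"
  shows "inj_on (tensor_map A C Q (\<lambda>x. x) f) (carrier (tensor_prod A C P))"
proof (rule inj_onI)
  fix s t
  assume s: "s \<in> carrier (tensor_prod A C P)" and t: "t \<in> carrier (tensor_prod A C P)"
    and eq: "tensor_map A C Q (\<lambda>x. x) f s = tensor_map A C Q (\<lambda>x. x) f t"
  define P' where "P' = transport_module eP P"
  define Q' where "Q' = transport_module eQ Q"
  define f' where "f' = (\<lambda>u. eQ (f (inv_into UNIV eP u)))"
  have C: "right_module A C" using flat by (simp add: flat_right_def)
  have P': "left_module A P'" and Q': "left_module A Q'"
    unfolding P'_def Q'_def using transport_left_module e P Q by blast+
  have eP: "left_linear A P P' eP" "left_linear A P' P (inv_into UNIV eP)"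
    and eQ: "left_linear A Q Q' eQ"
    unfolding P'_def Q'_def using transport_linear e by blast+
  note id = right_linear_id[of A C]
  have f': "left_linear A P' Q' f'"
    unfolding f'_def by (rule left_linear_comp[OF left_linear_comp[OF eP(2) f(1)] eQ])
  have "inj_on f' (carrier P')"
    by (intro inj_onI) (auto simp: f'_def P'_def transport_module_def inv_f_f[OF e(1)]
        inj_eq[OF e(2)] inj_on_eq_iff[OF f(2)])
  with flat P' Q' f' have inj: "inj_on (tensor_map A C Q' (\<lambda>x. x) f') (carrier (tensor_prod A C P'))"
    by (simp add: flat_right_def)
  define E where "E = tensor_map A C P' (\<lambda>x. x) eP"
  have E: "E u \<in> carrier (tensor_prod A C P')" if "u \<in> carrier (tensor_prod A C P)" for u
    unfolding E_def by (rule additive_map_closed[OF tensor_map_additive[OF C P C P' id eP(1)] that])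
  have "tensor_map A C Q' (\<lambda>x. x) f' (E u) =
      tensor_map A C Q' (\<lambda>x. x) eQ (tensor_map A C Q (\<lambda>x. x) f u)"
    if u: "u \<in> carrier (tensor_prod A C P)" for u
    unfolding E_def tensor_map_comp[OF C P C P' C Q' id id eP(1) f' u]
      tensor_map_comp[OF C P C Q C Q' id id f(1) eQ u]
    by (simp add: f'_def inv_f_f[OF e(1)])
  with eq s t have "tensor_map A C Q' (\<lambda>x. x) f' (E s) = tensor_map A C Q' (\<lambda>x. x) f' (E t)"
    by simp
  then have "E s = E t" using inj_onD[OF inj] E s t by blast
  moreover have "tensor_map A C P (\<lambda>x. x) (inv_into UNIV eP) (E u) = u"
    if u: "u \<in> carrier (tensor_prod A C P)" for u
    unfolding E_def tensor_map_comp[OF C P C P' C P id id eP u]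
    by (simp add: inv_f_f[OF e(1)] tensor_map_id[OF C P u])
  ultimately show "s = t" using s t by metis
qed


section \<open>Coideals of a flat coring\<close>

text \<open>
  For an injective linear \<open>i\<close>, linearity of \<open>r\<close> can be tested after composition with \<open>i\<close>.  It is applied
  to the restriction of the comultiplication to \<open>K\<close>, with \<open>i\<close> the inclusion of \<open>K \<otimes> C\<close> or
  \<open>C \<otimes> K\<close> into \<open>C \<otimes> C\<close>.
\<close>

lemma right_linear_through_injection:
  assumes K: "right_module A K" and i: "right_linear A T T' i" "inj_on i (carrier T)"
    and T: "right_module A T"
    and r: "\<And>x. x \<in> carrier K \<Longrightarrow> r x \<in> carrier T" and ir: "right_linear A K T' (\<lambda>x. i (r x))"
  shows "right_linear A K T r"
proof -
  note Kg = abelian_groupE(1)[OF right_module_group[OF K]] and Tg = abelian_groupE(1)[OF right_module_group[OF T]]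
  note Ka = right_module.ract_closed[OF K] and Ta = right_module.ract_closed[OF T]
  show ?thesis
    unfolding right_linear_def additive_map_def
  proof (intro conjI ballI)
    show "r \<in> carrier K \<rightarrow> carrier T" using r by blast
    fix x assume x: "x \<in> carrier K"
    show "r (x \<oplus>\<^bsub>K\<^esub> y) = r x \<oplus>\<^bsub>T\<^esub> r y" if y: "y \<in> carrier K" for y
      by (rule inj_onD[OF i(2)])
        (simp_all add: x y r Kg Tg additive_map_add[OF right_linear_additive[OF i(1)]]
          additive_map_add[OF right_linear_additive[OF ir]])
    show "r (x \<triangleleft>\<^bsub>K\<^esub> a) = r x \<triangleleft>\<^bsub>T\<^esub> a" if a: "a \<in> carrier A" for a
    proof (rule inj_onD[OF i(2)])
      show "i (r (x \<triangleleft>\<^bsub>K\<^esub> a)) = i (r x \<triangleleft>\<^bsub>T\<^esub> a)"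
        using i(1) ir x a r[OF x] by (simp add: right_linear_def)
    qed (simp_all add: x a r Ka Ta)
  qed
qed

lemma left_linear_through_injection:
  assumes K: "left_module A K" and i: "left_linear A T T' i" "inj_on i (carrier T)"
    and T: "left_module A T"
    and r: "\<And>x. x \<in> carrier K \<Longrightarrow> r x \<in> carrier T" and ir: "left_linear A K T' (\<lambda>x. i (r x))"
  shows "left_linear A K T r"
proof -
  note Kg = abelian_groupE(1)[OF left_module_group[OF K]] and Tg = abelian_groupE(1)[OF left_module_group[OF T]]
  note Ka = left_module.lact_closed[OF K] and Ta = left_module.lact_closed[OF T]
  show ?thesis
    unfolding left_linear_def additive_map_def
  proof (intro conjI ballI)
    show "r \<in> carrier K \<rightarrow> carrier T" using r by blast
    fix x assume x: "x \<in> carrier K"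
    show "r (x \<oplus>\<^bsub>K\<^esub> y) = r x \<oplus>\<^bsub>T\<^esub> r y" if y: "y \<in> carrier K" for y
      by (rule inj_onD[OF i(2)])
        (simp_all add: x y r Kg Tg additive_map_add[OF left_linear_additive[OF i(1)]]
          additive_map_add[OF left_linear_additive[OF ir]])
    fix a assume a: "a \<in> carrier A"
    show "r (a \<triangleright>\<^bsub>K\<^esub> x) = a \<triangleright>\<^bsub>T\<^esub> r x"
    proof (rule inj_onD[OF i(2)])
      show "i (r (a \<triangleright>\<^bsub>K\<^esub> x)) = i (a \<triangleright>\<^bsub>T\<^esub> r x)"
        using i(1) ir x a r[OF x] by (simp add: left_linear_def)
    qed (simp_all add: x a r Ka Ta)
  qed
qed

locale flat_coring = coring R A C
  for R :: "('r, 'q) ring_scheme" (structure) and A :: "('r, 'a, 'z) module_scheme" (structure)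
    and C :: "('a, 'c, 'w) coring_scheme" (structure) +
  assumes flat_left: "flat_left A C" and flat_right: "flat_right A C"
begin

abbreviation sub where "sub K \<equiv> C\<lparr>carrier := K\<rparr>"
abbreviation CC where "CC \<equiv> tensor_prod A C C"

text \<open>
  The map \<open>K \<otimes> C \<rightarrow> C \<otimes> C\<close> induced by the inclusion of a submodule \<open>K\<close>, and likewise
  \<open>C \<otimes> K \<rightarrow> C \<otimes> C\<close>.  As \<^const>\<open>tensor_map\<close> refers only to the codomain modules, one term denotes all
  of these maps; the domain shows in the carrier to which it is applied.  In the same way \<open>incl2\<close>
  denotes \<open>(K \<otimes> C) \<otimes> C \<rightarrow> (C \<otimes> C) \<otimes> C\<close>, \<open>(C \<otimes> C) \<otimes> K \<rightarrow> (C \<otimes> C) \<otimes> C\<close> and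
  \<open>(C \<otimes> K) \<otimes> C \<rightarrow> (C \<otimes> C) \<otimes> C\<close>.
\<close>

abbreviation incl where "incl \<equiv> tensor_map A C C (\<lambda>x. x) (\<lambda>x. x)"
abbreviation incl2 where "incl2 \<equiv> tensor_map A CC C incl (\<lambda>x. x)"

lemma C_bimod: "two_sided_module A C"
  by (rule bimodule_two_sided[OF bimodule_axioms])

lemmas CL = two_sidedD(1)[OF C_bimod]
lemmas CR = two_sidedD(2)[OF C_bimod]
lemmas CCL = left_module_tensor_prod[OF C_bimod CL]
lemmas CCR = right_module_tensor_prod[OF CR C_bimod]

lemma comult_closed: "x \<in> carrier C \<Longrightarrow> comult C x \<in> carrier CC"
  using additive_map_closed[OF left_linear_additive[OF comult_left_linear]] .

lemma incl_CC: "t \<in> carrier CC \<Longrightarrow> incl t = t"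
  by (rule tensor_map_id[OF CR CL])

lemma sub_right_linear: "K \<subseteq> carrier C \<Longrightarrow> right_linear A (sub K) C (\<lambda>x. x)"
  by (auto simp: right_linear_def additive_map_def)

lemma sub_left_linear: "K \<subseteq> carrier C \<Longrightarrow> left_linear A (sub K) C (\<lambda>x. x)"
  by (auto simp: left_linear_def additive_map_def)

lemma comult_sub_right_linear: "K \<subseteq> carrier C \<Longrightarrow> right_linear A (sub K) CC (comult C)"
  using right_linear_comp[OF sub_right_linear comult_right_linear] .

lemma comult_sub_left_linear: "K \<subseteq> carrier C \<Longrightarrow> left_linear A (sub K) CC (comult C)"
  using left_linear_comp[OF sub_left_linear comult_left_linear] .

text \<open>
  The test type has summands for the elements of \<open>C\<close> and for the tensors over \<open>C\<close>, and these two
  embeddings suffice: flatness is used once for \<open>K \<subseteq> C\<close> and once for the induced inclusion of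
  tensor products.
\<close>

lemma inj_c_universe: "inj (\<lambda>x. Inr (Inl x))"
  by (auto simp: inj_on_def)

lemma inj_tensor_universe: "inj (\<lambda>x. Inr (Inr x))"
  by (auto simp: inj_on_def)

lemma balanced_right_counit:
  assumes M: "right_module A M"
  shows "balanced A M C M (\<lambda>y c. y \<triangleleft>\<^bsub>M\<^esub> counit C c)"
proof -
  note e = additive_map_closed[OF counit_additive] additive_map_add[OF counit_additive]
  show ?thesis
    by (rule balancedI)
      (simp_all add: e counit_lact right_module.ract_closed[OF M] right_module.ract_distr[OF M]
        right_module.ract_distr_scalar[OF M] right_module.ract_assoc[OF M])
qed

lemma balanced_left_counit:
  assumes M: "left_module A M"
  shows "balanced A C M M (\<lambda>c y. counit C c \<triangleright>\<^bsub>M\<^esub> y)"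
proof -
  note e = additive_map_closed[OF counit_additive] additive_map_add[OF counit_additive]
  show ?thesis
    by (rule balancedI)
      (simp_all add: e counit_ract left_module.lact_closed[OF M] left_module.lact_distr[OF M]
        left_module.lact_distr_scalar[OF M] left_module.lact_assoc[OF M])
qed


subsection \<open>Right coideals\<close>

text \<open>
  The characterisation of right coideals that makes no mention of a coaction on \<open>K\<close>.
\<close>

definition right_stable :: "'c set \<Rightarrow> bool" where
  "right_stable K \<longleftrightarrow> K \<subseteq> carrier C \<and> right_module A (sub K) \<and>
     comult C ` K \<subseteq> incl ` carrier (tensor_prod A (sub K) C)"

definition right_restriction :: "'c set \<Rightarrow> 'c \<Rightarrow> ('c, 'c) tensor" where
  "right_restriction K x = inv_into (carrier (tensor_prod A (sub K) C)) incl (comult C x)"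

lemma right_coideal_stable: "K \<in> right_coideals R A C \<Longrightarrow> right_stable K"
proof -
  assume "K \<in> right_coideals R A C"
  then obtain \<rho> where K: "K \<subseteq> carrier C" and \<rho>: "right_comodule R A C (sub K) \<rho>"
    and colin: "right_colinear A C (sub K) \<rho> C (comult C) (\<lambda>x. x)"
    unfolding right_coideals_def right_subcomodules_def by blast
  interpret right_comodule R A C "sub K" \<rho> by (rule \<rho>)
  have "comult C x \<in> incl ` carrier (tensor_prod A (sub K) C)" if "x \<in> K" for x
    using colin that additive_map_closed[OF right_linear_additive[OF right_coaction_linear], of x]
    by (auto simp: right_colinear_def)
  with K \<rho> show "right_stable K"
    by (auto simp: right_stable_def right_comodule_def)
qed

context
  fixes K assumes K: "right_stable K"
begin

private abbreviation (input) "KC \<equiv> tensor_prod A (sub K) C"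
private abbreviation (input) "\<rho> \<equiv> right_restriction K"

lemma right_stableD: "K \<subseteq> carrier C" "right_module A (sub K)"
  using K by (simp_all add: right_stable_def)

private lemmas KC = right_module_tensor_prod[OF right_stableD(2) C_bimod]
private lemmas iK = sub_right_linear[OF right_stableD(1)]

lemma inj_incl_right: "inj_on incl (carrier KC)"
  by (rule flat_left_inj_on[OF flat_left right_stableD(2) CR iK _ inj_c_universe inj_c_universe])
    (simp add: inj_on_def)

lemma incl_right_linear: "right_linear A KC CC incl"
  by (rule tensor_map_right_linear[OF right_stableD(2) C_bimod CR C_bimod iK left_linear_id right_linear_id])

lemma inj_incl2_right: "inj_on incl2 (carrier (tensor_prod A KC C))"
  by (rule flat_left_inj_on[OF flat_left KC CCR incl_right_linear inj_incl_right
        inj_tensor_universe inj_tensor_universe])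

lemma right_restriction:
  assumes "x \<in> K"
  shows "\<rho> x \<in> carrier KC" "incl (\<rho> x) = comult C x"
proof -
  have "comult C x \<in> incl ` carrier KC" using K assms by (auto simp: right_stable_def)
  then show "\<rho> x \<in> carrier KC" "incl (\<rho> x) = comult C x"
    unfolding right_restriction_def by (rule inv_into_into, rule f_inv_into_f)
qed

lemma right_restriction_linear: "right_linear A (sub K) KC \<rho>"
proof (rule right_linear_through_injection[OF right_stableD(2) incl_right_linear inj_incl_right KC])
  show "x \<in> carrier (sub K) \<Longrightarrow> \<rho> x \<in> carrier KC" for x
    by (simp add: right_restriction(1))
  show "right_linear A (sub K) CC (\<lambda>x. incl (\<rho> x))"
    using comult_sub_right_linear[OF right_stableD(1)] abelian_groupE(1)[OF right_module_group[OF right_stableD(2)]]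
      right_module.ract_closed[OF right_stableD(2)]
    by (simp add: right_linear_def additive_map_def right_restriction(2) Pi_iff)
qed

lemma comult_first_right:
  assumes x: "x \<in> K"
  shows "tensor_map A CC C (comult C) (\<lambda>c. c) (\<rho> x) =
         tensor_map A CC C (comult C) (\<lambda>c. c) (comult C x)"
  using tensor_map_comp[OF right_stableD(2) CL CR CL CCR CL iK comult_right_linear
      left_linear_id left_linear_id right_restriction(1)[OF x]]
  by (simp add: right_restriction(2)[OF x])

lemma comult_second_right:
  assumes x: "x \<in> K"
  shows "tensor_map A C CC (\<lambda>c. c) (comult C) (\<rho> x) =
         tensor_map A C CC (\<lambda>c. c) (comult C) (comult C x)"
  using tensor_map_comp[OF right_stableD(2) CL CR CL CR CCL iK right_linear_id
      left_linear_id comult_left_linear right_restriction(1)[OF x]]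
  by (simp add: right_restriction(2)[OF x])

text \<open>
  Both sides of the coassociativity law lie in \<open>(K \<otimes> C) \<otimes> C\<close>, which embeds into \<open>(C \<otimes> C) \<otimes> C\<close>.
  There they become \<open>(\<Delta> \<otimes> id) (\<Delta> x)\<close> and, by naturality of associativity,
  \<open>(id \<otimes> \<Delta>) (\<Delta> x)\<close>, so that coassociativity of the coring applies.  The counit law is read off in
  \<open>C\<close> in the same manner.
\<close>

lemma right_restriction_comodule: "right_comodule R A C (sub K) \<rho>"
proof (intro right_comodule.intro right_comodule_axioms.intro coring_axioms right_stableD(2)
    right_restriction_linear)
  fix x assume "x \<in> carrier (sub K)"
  then have x: "x \<in> K" and xC: "x \<in> carrier C" using right_stableD(1) by auto
  note \<rho> = right_restriction(1)[OF x]
  let ?L = "tensor_map A KC C \<rho> (\<lambda>c. c) (\<rho> x)"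
  let ?s = "tensor_map A (sub K) CC (\<lambda>y. y) (comult C) (\<rho> x)"
  let ?R = "tensor_assoc A (sub K) C C ?s"
  note id = left_linear_id[of A C]
  note D = comult_sub_right_linear[OF right_stableD(1)]
  have s: "?s \<in> carrier (tensor_prod A (sub K) CC)"
    by (rule additive_map_closed[OF tensor_map_additive[OF right_stableD(2) CL right_stableD(2) CCL
            right_linear_id comult_left_linear] \<rho>])
  show "?L = ?R"
  proof (rule inj_onD[OF inj_incl2_right])
    show "?L \<in> carrier (tensor_prod A KC C)"
      by (rule additive_map_closed[OF tensor_map_additive[OF right_stableD(2) CL KC CL
              right_restriction_linear id] \<rho>])
    show "?R \<in> carrier (tensor_prod A KC C)"
      by (rule additive_map_closed[OF tensor_assoc_additive[OF right_stableD(2) C_bimod CL] s])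
    have "incl2 ?L = tensor_map A CC C (\<lambda>x. incl (\<rho> x)) (\<lambda>c. c) (\<rho> x)"
      by (rule tensor_map_comp[OF right_stableD(2) CL KC CL CCR CL right_restriction_linear
            incl_right_linear id id \<rho>])
    also have "\<dots> = tensor_map A CC C (comult C) (\<lambda>c. c) (\<rho> x)"
      by (rule tensor_map_cong[OF right_stableD(2) CL CCR CL
            right_linear_comp[OF right_restriction_linear incl_right_linear] D id id _ _ \<rho>])
        (simp_all add: right_restriction(2))
    also have "\<dots> = tensor_map A CC C (comult C) (\<lambda>c. c) (comult C x)"
      by (rule comult_first_right[OF x])
    also have "\<dots> = tensor_assoc A C C C (tensor_map A C CC (\<lambda>c. c) (comult C) (comult C x))"
      by (rule coassoc[OF xC])
    also have "tensor_map A C CC (\<lambda>c. c) (comult C) (comult C x) =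
        tensor_map A C CC (\<lambda>c. c) (comult C) (\<rho> x)"
      by (rule comult_second_right[OF x, symmetric])
    also have "\<dots> = tensor_map A C CC (\<lambda>c. c) (\<lambda>c. incl (comult C c)) (\<rho> x)"
      by (rule tensor_map_cong[OF right_stableD(2) CL CR CCL iK iK comult_left_linear
            left_linear_comp[OF comult_left_linear tensor_map_left_linear[OF C_bimod CL C_bimod CL
                right_linear_id left_linear_id left_linear_id]] _ _ \<rho>])
        (simp_all add: incl_CC comult_closed)
    also have "\<dots> = tensor_map A C CC (\<lambda>c. c) incl ?s"
      by (rule tensor_map_comp[OF right_stableD(2) CL right_stableD(2) CCL CR CCL right_linear_id iK
            comult_left_linear tensor_map_left_linear[OF C_bimod CL C_bimod CL
                right_linear_id left_linear_id left_linear_id] \<rho>, symmetric])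
    also have "tensor_assoc A C C C (tensor_map A C CC (\<lambda>c. c) incl ?s) = incl2 ?R"
      by (rule tensor_assoc_natural[OF right_stableD(2) C_bimod CL CR C_bimod CL iK left_linear_id
            right_linear_id left_linear_id s])
    finally show "incl2 ?L = incl2 ?R" .
  qed
  note b = balanced_right_counit[OF right_stableD(2)] and bC = balanced_right_counit[OF CR]
  note Kg = right_module_group[OF right_stableD(2)] and Cg = right_module_group[OF CR]
  have "tensor_lift (sub K) (\<lambda>y c. y \<triangleleft>\<^bsub>sub K\<^esub> counit C c) (\<rho> x) =
      tensor_lift C (\<lambda>y c. y \<triangleleft>\<^bsub>C\<^esub> counit C c) (\<rho> x)"
  proof (rule tensor_maps_eqI[OF right_stableD(2) CL
        additive_map_comp[OF tensor_lift_additive[OF right_stableD(2) CL Kg b] right_linear_additive[OF iK]]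
        tensor_lift_additive[OF right_stableD(2) CL Cg balanced_precomp[OF bC iK left_linear_id]] _ \<rho>])
    show "tensor_lift (sub K) (\<lambda>y c. y \<triangleleft>\<^bsub>sub K\<^esub> counit C c) (pure_tensor A (sub K) C y c) =
        tensor_lift C (\<lambda>y c. y \<triangleleft>\<^bsub>C\<^esub> counit C c) (pure_tensor A (sub K) C y c)"
      if "y \<in> carrier (sub K)" "c \<in> carrier C" for y c
      unfolding tensor_lift_pure[OF right_stableD(2) CL Kg b that]
        tensor_lift_pure[OF right_stableD(2) CL Cg balanced_precomp[OF bC iK left_linear_id] that]
      by simp
  qed
  also have "\<dots> = tensor_lift C (\<lambda>y c. y \<triangleleft>\<^bsub>C\<^esub> counit C c) (incl (\<rho> x))"
    by (rule tensor_lift_tensor_map[OF right_stableD(2) CL CR CL iK left_linear_id Cg bC \<rho>, symmetric])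
  also have "\<dots> = x"
    unfolding right_restriction(2)[OF x] by (rule counit_right[OF xC])
  finally show "tensor_lift (sub K) (\<lambda>y c. y \<triangleleft>\<^bsub>sub K\<^esub> counit C c) (\<rho> x) = x" .
qed

lemma right_restriction_colinear: "right_colinear A C (sub K) \<rho> C (comult C) (\<lambda>x. x)"
  using iK right_restriction(2) by (simp add: right_colinear_def)

lemma right_stable_coideal: "K \<in> right_coideals R A C"
  unfolding right_coideals_def right_subcomodules_def
  using right_stableD(1) right_restriction_comodule right_restriction_colinear by blast

end

lemma right_coideal_iff: "K \<in> right_coideals R A C \<longleftrightarrow> right_stable K"
  using right_coideal_stable right_stable_coideal by blast


subsection \<open>Left coideals\<close>

definition left_stable :: "'c set \<Rightarrow> bool" where
  "left_stable K \<longleftrightarrow> K \<subseteq> carrier C \<and> left_module A (sub K) \<and>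
     comult C ` K \<subseteq> incl ` carrier (tensor_prod A C (sub K))"

definition left_restriction :: "'c set \<Rightarrow> 'c \<Rightarrow> ('c, 'c) tensor" where
  "left_restriction K x = inv_into (carrier (tensor_prod A C (sub K))) incl (comult C x)"

lemma left_coideal_stable: "K \<in> left_coideals R A C \<Longrightarrow> left_stable K"
proof -
  assume "K \<in> left_coideals R A C"
  then obtain \<sigma> where K: "K \<subseteq> carrier C" and \<sigma>: "left_comodule R A C (sub K) \<sigma>"
    and colin: "left_colinear A C (sub K) \<sigma> C (comult C) (\<lambda>x. x)"
    unfolding left_coideals_def left_subcomodules_def by blast
  interpret left_comodule R A C "sub K" \<sigma> by (rule \<sigma>)
  have "comult C x \<in> incl ` carrier (tensor_prod A C (sub K))" if "x \<in> K" for x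
    using colin that additive_map_closed[OF left_linear_additive[OF left_coaction_linear], of x]
    by (auto simp: left_colinear_def)
  with K \<sigma> show "left_stable K"
    by (auto simp: left_stable_def left_comodule_def)
qed

context
  fixes K assumes K: "left_stable K"
begin

private abbreviation (input) "CK \<equiv> tensor_prod A C (sub K)"
private abbreviation (input) "\<sigma> \<equiv> left_restriction K"

lemma left_stableD: "K \<subseteq> carrier C" "left_module A (sub K)"
  using K by (simp_all add: left_stable_def)

private lemmas CK = left_module_tensor_prod[OF C_bimod left_stableD(2)]
private lemmas iK_left = sub_left_linear[OF left_stableD(1)]

lemma inj_incl_left: "inj_on incl (carrier CK)"
  by (rule flat_right_inj_on[OF flat_right left_stableD(2) CL iK_left _ inj_c_universe inj_c_universe])
    (simp add: inj_on_def)

lemma incl_left_linear: "left_linear A CK CC incl"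
  by (rule tensor_map_left_linear[OF C_bimod left_stableD(2) C_bimod CL right_linear_id left_linear_id iK_left])

text \<open>
  Flatness of \<open>C\<close> as a right module concerns \<open>C \<otimes> -\<close> and gives injectivity of
  \<open>C \<otimes> (C \<otimes> K) \<rightarrow> C \<otimes> (C \<otimes> C)\<close>.  The associativity isomorphisms at both ends carry this over to
  \<open>(C \<otimes> C) \<otimes> K \<rightarrow> (C \<otimes> C) \<otimes> C\<close>, where the coassociativity law of a left comodule lives.
\<close>

lemma inj_incl2_left: "inj_on incl2 (carrier (tensor_prod A CC (sub K)))"
proof (rule inj_onI)
  fix s t
  assume s: "s \<in> carrier (tensor_prod A CC (sub K))" and t: "t \<in> carrier (tensor_prod A CC (sub K))"
    and eq: "incl2 s = incl2 t"
  let ?id_incl = "tensor_map A C CC (\<lambda>c. c) incl"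
  have inj: "inj_on ?id_incl (carrier (tensor_prod A C CK))"
    by (rule flat_right_inj_on[OF flat_right CK CCL incl_left_linear inj_incl_left
          inj_tensor_universe inj_tensor_universe])
  have closed: "?id_incl u \<in> carrier (tensor_prod A C CC)" if "u \<in> carrier (tensor_prod A C CK)" for u
    by (rule additive_map_closed[OF tensor_map_additive[OF CR CK CR CCL right_linear_id
            incl_left_linear] that])
  have natural: "tensor_assoc A C C C (?id_incl u) = incl2 (tensor_assoc A C C (sub K) u)"
    if "u \<in> carrier (tensor_prod A C CK)" for u
    by (rule tensor_assoc_natural[OF CR C_bimod left_stableD(2) CR C_bimod CL right_linear_id left_linear_id
          right_linear_id iK_left that])
  note surj = bij_betw_imp_surj_on[OF tensor_assoc_bij_betw[OF CR C_bimod left_stableD(2)], symmetric]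
  note assoc_inj = bij_betw_imp_inj_on[OF tensor_assoc_bij_betw[OF CR C_bimod CL]]
  obtain u where u: "s = tensor_assoc A C C (sub K) u" "u \<in> carrier (tensor_prod A C CK)"
    using s unfolding surj by (rule imageE)
  obtain v where v: "t = tensor_assoc A C C (sub K) v" "v \<in> carrier (tensor_prod A C CK)"
    using t unfolding surj by (rule imageE)
  have "tensor_assoc A C C C (?id_incl u) = tensor_assoc A C C C (?id_incl v)"
    unfolding natural[OF u(2)] natural[OF v(2)] u(1)[symmetric] v(1)[symmetric] by (rule eq)
  then have "?id_incl u = ?id_incl v"
    by (rule inj_onD[OF assoc_inj _ closed[OF u(2)] closed[OF v(2)]])
  then have "u = v"
    by (rule inj_onD[OF inj _ u(2) v(2)])
  then show "s = t" unfolding u(1) v(1) by (rule arg_cong)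
qed

lemma left_restriction:
  assumes "x \<in> K"
  shows "\<sigma> x \<in> carrier CK" "incl (\<sigma> x) = comult C x"
proof -
  have "comult C x \<in> incl ` carrier CK" using K assms by (auto simp: left_stable_def)
  then show "\<sigma> x \<in> carrier CK" "incl (\<sigma> x) = comult C x"
    unfolding left_restriction_def by (rule inv_into_into, rule f_inv_into_f)
qed

lemma left_restriction_linear: "left_linear A (sub K) CK \<sigma>"
proof (rule left_linear_through_injection[OF left_stableD(2) incl_left_linear inj_incl_left CK])
  show "x \<in> carrier (sub K) \<Longrightarrow> \<sigma> x \<in> carrier CK" for x
    by (simp add: left_restriction(1))
  show "left_linear A (sub K) CC (\<lambda>x. incl (\<sigma> x))"
    using comult_sub_left_linear[OF left_stableD(1)] abelian_groupE(1)[OF left_module_group[OF left_stableD(2)]]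
      left_module.lact_closed[OF left_stableD(2)]
    by (simp add: left_linear_def additive_map_def left_restriction(2) Pi_iff)
qed

lemma comult_first_left:
  assumes x: "x \<in> K"
  shows "tensor_map A CC C (comult C) (\<lambda>c. c) (\<sigma> x) =
         tensor_map A CC C (comult C) (\<lambda>c. c) (comult C x)"
  using tensor_map_comp[OF CR left_stableD(2) CR CL CCR CL right_linear_id comult_right_linear
      iK_left left_linear_id left_restriction(1)[OF x]]
  by (simp add: left_restriction(2)[OF x])

lemma comult_second_left:
  assumes x: "x \<in> K"
  shows "tensor_map A C CC (\<lambda>c. c) (comult C) (\<sigma> x) =
         tensor_map A C CC (\<lambda>c. c) (comult C) (comult C x)"
  using tensor_map_comp[OF CR left_stableD(2) CR CL CR CCL right_linear_id right_linear_id
      iK_left comult_left_linear left_restriction(1)[OF x]]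
  by (simp add: left_restriction(2)[OF x])

lemma left_restriction_comodule: "left_comodule R A C (sub K) \<sigma>"
proof (intro left_comodule.intro left_comodule_axioms.intro coring_axioms left_stableD(2)
    left_restriction_linear)
  fix x assume "x \<in> carrier (sub K)"
  then have x: "x \<in> K" and xC: "x \<in> carrier C" using left_stableD(1) by auto
  note \<sigma> = left_restriction(1)[OF x]
  let ?L = "tensor_map A CC (sub K) (comult C) (\<lambda>y. y) (\<sigma> x)"
  let ?s = "tensor_map A C CK (\<lambda>c. c) \<sigma> (\<sigma> x)"
  let ?R = "tensor_assoc A C C (sub K) ?s"
  note id = right_linear_id[of A C]
  note D = comult_sub_left_linear[OF left_stableD(1)]
  note incl_rl = tensor_map_right_linear[OF CR C_bimod CR C_bimod right_linear_id left_linear_id right_linear_id]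
  have s: "?s \<in> carrier (tensor_prod A C CK)"
    by (rule additive_map_closed[OF tensor_map_additive[OF CR left_stableD(2) CR CK
            id left_restriction_linear] \<sigma>])
  show "?L = ?R"
  proof (rule inj_onD[OF inj_incl2_left])
    show "?L \<in> carrier (tensor_prod A CC (sub K))"
      by (rule additive_map_closed[OF tensor_map_additive[OF CR left_stableD(2) CCR left_stableD(2)
              comult_right_linear left_linear_id] \<sigma>])
    show "?R \<in> carrier (tensor_prod A CC (sub K))"
      by (rule additive_map_closed[OF tensor_assoc_additive[OF CR C_bimod left_stableD(2)] s])
    have "incl2 ?L = tensor_map A CC C (\<lambda>c. incl (comult C c)) (\<lambda>y. y) (\<sigma> x)"
      by (rule tensor_map_comp[OF CR left_stableD(2) CCR left_stableD(2) CCR CL comult_right_linear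
            incl_rl left_linear_id iK_left \<sigma>])
    also have "\<dots> = tensor_map A CC C (comult C) (\<lambda>y. y) (\<sigma> x)"
      by (rule tensor_map_cong[OF CR left_stableD(2) CCR CL
            right_linear_comp[OF comult_right_linear incl_rl] comult_right_linear iK_left iK_left _ _ \<sigma>])
        (simp_all add: incl_CC comult_closed)
    also have "\<dots> = tensor_map A CC C (comult C) (\<lambda>c. c) (comult C x)"
      by (rule comult_first_left[OF x])
    also have "\<dots> = tensor_assoc A C C C (tensor_map A C CC (\<lambda>c. c) (comult C) (comult C x))"
      by (rule coassoc[OF xC])
    also have "tensor_map A C CC (\<lambda>c. c) (comult C) (comult C x) =
        tensor_map A C CC (\<lambda>c. c) (comult C) (\<sigma> x)"
      by (rule comult_second_left[OF x, symmetric])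
    also have "\<dots> = tensor_map A C CC (\<lambda>c. c) (\<lambda>y. incl (\<sigma> y)) (\<sigma> x)"
      by (rule tensor_map_cong[OF CR left_stableD(2) CR CCL id id D
            left_linear_comp[OF left_restriction_linear incl_left_linear] _ _ \<sigma>])
        (simp_all add: left_restriction(2))
    also have "\<dots> = tensor_map A C CC (\<lambda>c. c) incl ?s"
      by (rule tensor_map_comp[OF CR left_stableD(2) CR CK CR CCL id id
            left_restriction_linear incl_left_linear \<sigma>, symmetric])
    also have "tensor_assoc A C C C (tensor_map A C CC (\<lambda>c. c) incl ?s) = incl2 ?R"
      by (rule tensor_assoc_natural[OF CR C_bimod left_stableD(2) CR C_bimod CL id left_linear_id
            right_linear_id iK_left s])
    finally show "incl2 ?L = incl2 ?R" .
  qed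
  note b = balanced_left_counit[OF left_stableD(2)] and bC = balanced_left_counit[OF CL]
  note Kg = left_module_group[OF left_stableD(2)] and Cg = left_module_group[OF CL]
  have "tensor_lift (sub K) (\<lambda>c y. counit C c \<triangleright>\<^bsub>sub K\<^esub> y) (\<sigma> x) =
      tensor_lift C (\<lambda>c y. counit C c \<triangleright>\<^bsub>C\<^esub> y) (\<sigma> x)"
  proof (rule tensor_maps_eqI[OF CR left_stableD(2)
        additive_map_comp[OF tensor_lift_additive[OF CR left_stableD(2) Kg b] left_linear_additive[OF iK_left]]
        tensor_lift_additive[OF CR left_stableD(2) Cg balanced_precomp[OF bC id iK_left]] _ \<sigma>])
    show "tensor_lift (sub K) (\<lambda>c y. counit C c \<triangleright>\<^bsub>sub K\<^esub> y) (pure_tensor A C (sub K) c y) =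
        tensor_lift C (\<lambda>c y. counit C c \<triangleright>\<^bsub>C\<^esub> y) (pure_tensor A C (sub K) c y)"
      if "c \<in> carrier C" "y \<in> carrier (sub K)" for c y
      unfolding tensor_lift_pure[OF CR left_stableD(2) Kg b that]
        tensor_lift_pure[OF CR left_stableD(2) Cg balanced_precomp[OF bC id iK_left] that]
      by simp
  qed
  also have "\<dots> = tensor_lift C (\<lambda>c y. counit C c \<triangleright>\<^bsub>C\<^esub> y) (incl (\<sigma> x))"
    by (rule tensor_lift_tensor_map[OF CR left_stableD(2) CR CL id iK_left Cg bC \<sigma>, symmetric])
  also have "\<dots> = x"
    unfolding left_restriction(2)[OF x] by (rule counit_left[OF xC])
  finally show "tensor_lift (sub K) (\<lambda>c y. counit C c \<triangleright>\<^bsub>sub K\<^esub> y) (\<sigma> x) = x" .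
qed

lemma left_restriction_colinear: "left_colinear A C (sub K) \<sigma> C (comult C) (\<lambda>x. x)"
  using iK_left left_restriction(2) by (simp add: left_colinear_def)

lemma left_stable_coideal: "K \<in> left_coideals R A C"
  unfolding left_coideals_def left_subcomodules_def
  using left_stableD(1) left_restriction_comodule left_restriction_colinear by blast

end

lemma left_coideal_iff: "K \<in> left_coideals R A C \<longleftrightarrow> left_stable K"
  using left_coideal_stable left_stable_coideal by blast


subsection \<open>Bicoideals\<close>

lemma sub_bimodule:
  assumes "K \<subseteq> carrier C" "left_module A (sub K)" "right_module A (sub K)"
  shows "bimodule R A (sub K)"
  using assms act_commute central assoc_algebra_axioms
  by (intro bimodule.intro bimodule_axioms.intro) auto

text \<open>
  The two restricted coactions commute because, after embedding into \<open>(C \<otimes> C) \<otimes> C\<close>, this is again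
  coassociativity of the coring.
\<close>

lemma bicomodule_restriction:
  assumes r: "right_stable K" and l: "left_stable K"
  shows "bicomodule R A C (sub K) (left_restriction K) (right_restriction K)"
proof -
  let ?K = "sub K" and ?\<rho> = "right_restriction K" and ?\<sigma> = "left_restriction K"
  let ?KC = "tensor_prod A ?K C" and ?CK = "tensor_prod A C ?K"
  note K = right_stableD[OF r] left_stableD(2)[OF l]
  note i = sub_right_linear[OF K(1)] sub_left_linear[OF K(1)]
  have bi: "bimodule R A ?K" by (rule sub_bimodule[OF K(1,3,2)])
  note K2 = bimodule_two_sided[OF bi]
  note CKR = right_module_tensor_prod[OF CR K2] and KCL = left_module_tensor_prod[OF K2 CL]
  have \<sigma>_incl: "right_linear A ?CK CC incl"
    by (rule tensor_map_right_linear[OF CR K2 CR C_bimod right_linear_id i(2,1)])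
  have \<rho>_incl: "left_linear A ?KC CC incl"
    by (rule tensor_map_left_linear[OF K2 CL C_bimod CL i left_linear_id])
  have \<sigma>_right: "right_linear A ?K ?CK ?\<sigma>"
  proof (rule right_linear_through_injection[OF K(2) \<sigma>_incl inj_incl_left[OF l] CKR])
    show "x \<in> carrier ?K \<Longrightarrow> ?\<sigma> x \<in> carrier ?CK" for x
      by (simp add: left_restriction(1)[OF l])
    show "right_linear A ?K CC (\<lambda>x. incl (?\<sigma> x))"
      using comult_sub_right_linear[OF K(1)] abelian_groupE(1)[OF right_module_group[OF K(2)]]
        right_module.ract_closed[OF K(2)]
      by (simp add: right_linear_def additive_map_def left_restriction(2)[OF l] Pi_iff)
  qed
  have \<rho>_left: "left_linear A ?K ?KC ?\<rho>"
  proof (rule left_linear_through_injection[OF K(3) \<rho>_incl inj_incl_right[OF r] KCL])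
    show "x \<in> carrier ?K \<Longrightarrow> ?\<rho> x \<in> carrier ?KC" for x
      by (simp add: right_restriction(1)[OF r])
    show "left_linear A ?K CC (\<lambda>x. incl (?\<rho> x))"
      using comult_sub_left_linear[OF K(1)] abelian_groupE(1)[OF left_module_group[OF K(3)]]
        left_module.lact_closed[OF K(3)]
      by (simp add: left_linear_def additive_map_def right_restriction(2)[OF r] Pi_iff)
  qed
  have inj: "inj_on incl2 (carrier (tensor_prod A ?CK C))"
    by (rule flat_left_inj_on[OF flat_left CKR CCR \<sigma>_incl inj_incl_left[OF l]
          inj_tensor_universe inj_tensor_universe])
  show ?thesis
  proof (intro bicomodule.intro bicomodule_axioms.intro bi right_restriction_comodule[OF r]
      left_restriction_comodule[OF l] \<sigma>_right \<rho>_left)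
    fix x assume "x \<in> carrier ?K"
    then have x: "x \<in> K" and xC: "x \<in> carrier C" using K(1) by auto
    note \<rho> = right_restriction(1)[OF r x] and \<sigma> = left_restriction(1)[OF l x]
    let ?L = "tensor_map A ?CK C ?\<sigma> (\<lambda>c. c) (?\<rho> x)"
    let ?s = "tensor_map A C ?KC (\<lambda>c. c) ?\<rho> (?\<sigma> x)"
    let ?R = "tensor_assoc A C ?K C ?s"
    have s: "?s \<in> carrier (tensor_prod A C ?KC)"
      by (rule additive_map_closed[OF tensor_map_additive[OF CR K(3) CR KCL
              right_linear_id \<rho>_left] \<sigma>])
    show "?L = ?R"
    proof (rule inj_onD[OF inj])
      show "?L \<in> carrier (tensor_prod A ?CK C)"
        by (rule additive_map_closed[OF tensor_map_additive[OF K(2) CL CKR CL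
                \<sigma>_right left_linear_id] \<rho>])
      show "?R \<in> carrier (tensor_prod A ?CK C)"
        by (rule additive_map_closed[OF tensor_assoc_additive[OF CR K2 CL] s])
      have "incl2 ?L = tensor_map A CC C (\<lambda>x. incl (?\<sigma> x)) (\<lambda>c. c) (?\<rho> x)"
        by (rule tensor_map_comp[OF K(2) CL CKR CL CCR CL \<sigma>_right \<sigma>_incl
              left_linear_id left_linear_id \<rho>])
      also have "\<dots> = tensor_map A CC C (comult C) (\<lambda>c. c) (?\<rho> x)"
        by (rule tensor_map_cong[OF K(2) CL CCR CL right_linear_comp[OF \<sigma>_right \<sigma>_incl]
              comult_sub_right_linear[OF K(1)] left_linear_id left_linear_id _ _ \<rho>])
          (simp_all add: left_restriction(2)[OF l])
      also have "\<dots> = tensor_map A CC C (comult C) (\<lambda>c. c) (comult C x)"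
        by (rule comult_first_right[OF r x])
      also have "\<dots> = tensor_assoc A C C C (tensor_map A C CC (\<lambda>c. c) (comult C) (comult C x))"
        by (rule coassoc[OF xC])
      also have "tensor_map A C CC (\<lambda>c. c) (comult C) (comult C x) =
          tensor_map A C CC (\<lambda>c. c) (comult C) (?\<sigma> x)"
        by (rule comult_second_left[OF l x, symmetric])
      also have "\<dots> = tensor_map A C CC (\<lambda>c. c) (\<lambda>y. incl (?\<rho> y)) (?\<sigma> x)"
        by (rule tensor_map_cong[OF CR K(3) CR CCL right_linear_id right_linear_id
              comult_sub_left_linear[OF K(1)] left_linear_comp[OF \<rho>_left \<rho>_incl] _ _ \<sigma>])
          (simp_all add: right_restriction(2)[OF r])
      also have "\<dots> = tensor_map A C CC (\<lambda>c. c) incl ?s"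
        by (rule tensor_map_comp[OF CR K(3) CR KCL CR CCL right_linear_id right_linear_id
              \<rho>_left \<rho>_incl \<sigma>, symmetric])
      also have "tensor_assoc A C C C (tensor_map A C CC (\<lambda>c. c) incl ?s) = incl2 ?R"
        by (rule tensor_assoc_natural[OF CR K2 CL CR C_bimod CL right_linear_id i(2,1) left_linear_id s])
      finally show "incl2 ?L = incl2 ?R" .
    qed
  qed
qed

lemma bicoideals_eq: "bicoideals R A C = left_coideals R A C \<inter> right_coideals R A C"
proof (intro equalityI subsetI)
  fix K assume "K \<in> bicoideals R A C"
  then obtain \<sigma> \<rho> where K: "K \<subseteq> carrier C" and bi: "bicomodule R A C (sub K) \<sigma> \<rho>"
    and colin: "left_colinear A C (sub K) \<sigma> C (comult C) (\<lambda>x. x)"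
      "right_colinear A C (sub K) \<rho> C (comult C) (\<lambda>x. x)"
    unfolding bicoideals_def subbicomodules_def by blast
  then have "left_comodule R A C (sub K) \<sigma>" "right_comodule R A C (sub K) \<rho>"
    by (simp_all add: bicomodule_def)
  with K colin show "K \<in> left_coideals R A C \<inter> right_coideals R A C"
    unfolding left_coideals_def left_subcomodules_def right_coideals_def right_subcomodules_def by blast
next
  fix K assume "K \<in> left_coideals R A C \<inter> right_coideals R A C"
  then have "left_stable K" "right_stable K" by (simp_all add: left_coideal_iff right_coideal_iff)
  then show "K \<in> bicoideals R A C"
    unfolding bicoideals_def subbicomodules_def
    using bicomodule_restriction left_restriction_colinear right_restriction_colinear left_stableD(1)
    by blast
qed

end


section \<open>Sums of coideals\<close>

text \<open>
  Each closure property of a sum of coideals says that an additive map sends the sum into some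
  subgroup; it is then enough to look at the summands.
\<close>

lemma additive_map_generate_subset:
  assumes M: "abelian_group M" "abelian_group N" and f: "additive_map M N f"
    and U: "U \<subseteq> carrier M" and V: "subgroup V (add_monoid N)" "f ` U \<subseteq> V"
  shows "f ` generate (add_monoid M) U \<subseteq> V"
proof -
  interpret f: group_hom "add_monoid M" "add_monoid N" f
    by (rule additive_map_group_hom[OF M f])
  have "f ` generate (add_monoid M) U = generate (add_monoid N) (f ` U)"
    using f.generate_img[of U] U by simp
  also have "\<dots> \<subseteq> V"
    by (rule f.H.generate_subgroup_incl[OF V(2,1)])
  finally show ?thesis .
qed

lemma additive_map_image_subgroup:
  assumes M: "abelian_group M" "abelian_group N" and f: "additive_map M N f"
  shows "subgroup (f ` carrier M) (add_monoid N)"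
  using group_hom.img_is_subgroup[OF additive_map_group_hom[OF M f]] by simp

lemma abelian_group_restrict_iff:
  fixes M :: "('m, 'x) ring_scheme"
  assumes M: "abelian_group M" and K: "K \<subseteq> carrier M"
  shows "abelian_group (M\<lparr>carrier := K\<rparr>) \<longleftrightarrow> subgroup K (add_monoid M)"
proof
  interpret M: abelian_group M by (rule M)
  show "subgroup K (add_monoid M)" if group: "abelian_group (M\<lparr>carrier := K\<rparr>)"
  proof (rule subgroup.intro)
    note g = abelian_groupE[OF group, simplified]
    show "inv\<^bsub>add_monoid M\<^esub> x \<in> K" if x: "x \<in> K" for x
    proof -
      obtain y where y: "y \<in> K" "y \<oplus>\<^bsub>M\<^esub> x = \<zero>\<^bsub>M\<^esub>" using g(6)[OF x] by blast
      have xy: "x \<in> carrier M" "y \<in> carrier M" using x y(1) K by auto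
      then have "\<ominus>\<^bsub>M\<^esub> x = y" using M.minus_equality[OF y(2)] by simp
      with y(1) show ?thesis by (simp add: a_inv_def)
    qed
  qed (use K abelian_groupE[OF group] in auto)
  show "abelian_group (M\<lparr>carrier := K\<rparr>)" if sub: "subgroup K (add_monoid M)"
  proof (rule abelian_groupI)
    show "\<exists>y\<in>carrier (M\<lparr>carrier := K\<rparr>). y \<oplus>\<^bsub>M\<lparr>carrier := K\<rparr>\<^esub> x = \<zero>\<^bsub>M\<lparr>carrier := K\<rparr>\<^esub>"
      if "x \<in> carrier (M\<lparr>carrier := K\<rparr>)" for x
      using that subgroup.m_inv_closed[OF sub, of x] M.l_neg[of x] subsetD[OF K]
      by (intro bexI[of _ "\<ominus>\<^bsub>M\<^esub> x"]) (auto simp: a_inv_def)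
  qed (use subgroup.one_closed[OF sub] subgroup.m_closed[OF sub] subsetD[OF K] in
      \<open>auto simp: M.a_ac\<close>)
qed

context flat_coring
begin

lemma C_group: "abelian_group C"
  by (rule right_module_group[OF CR])

abbreviation sum_of where "sum_of \<F> \<equiv> generate (add_monoid C) (\<Union>\<F>)"

lemma right_stable_subgroup: "right_stable K \<Longrightarrow> subgroup K (add_monoid C)"
  using right_module_group abelian_group_restrict_iff[OF C_group] by (auto simp: right_stable_def)

lemma left_stable_subgroup: "left_stable K \<Longrightarrow> subgroup K (add_monoid C)"
  using left_module_group abelian_group_restrict_iff[OF C_group] by (auto simp: left_stable_def)

lemma
  assumes "\<Union>\<F> \<subseteq> carrier C"
  shows sum_of_subgroup: "subgroup (sum_of \<F>) (add_monoid C)"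
    and sum_of_carrier: "sum_of \<F> \<subseteq> carrier C"
    and sum_of_upper: "K \<in> \<F> \<Longrightarrow> K \<subseteq> sum_of \<F>"
proof -
  show "subgroup (sum_of \<F>) (add_monoid C)"
    using abelian_group.a_group[OF C_group] assms by (intro group.generate_is_subgroup) auto
  then show "sum_of \<F> \<subseteq> carrier C" using subgroup.subset by fastforce
  show "K \<in> \<F> \<Longrightarrow> K \<subseteq> sum_of \<F>" by (auto intro: generate.incl)
qed

text \<open>
  For a summand \<open>K\<close> of \<open>S\<close> the image of \<open>K \<otimes> C\<close> in \<open>C \<otimes> C\<close> is contained in that of \<open>S \<otimes> C\<close>, since
  the inclusion of \<open>K\<close> factors through \<open>S\<close>.
\<close>

lemma right_stable_sum_of:
  assumes \<F>: "\<And>K. K \<in> \<F> \<Longrightarrow> right_stable K"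
  shows "right_stable (sum_of \<F>)"
proof -
  let ?S = "sum_of \<F>"
  have ring: "ring A" using CR by (simp add: right_module_def)
  have U: "\<Union>\<F> \<subseteq> carrier C" using \<F> by (auto simp: right_stable_def)
  note S = sum_of_subgroup[OF U] sum_of_carrier[OF U]
  note upper = sum_of_upper[OF U]
  have "x \<triangleleft>\<^bsub>C\<^esub> a \<in> ?S" if a: "a \<in> carrier A" and x: "x \<in> ?S" for a x
  proof -
    have "(\<lambda>x. x \<triangleleft>\<^bsub>C\<^esub> a) ` ?S \<subseteq> ?S"
    proof (rule additive_map_generate_subset[OF C_group C_group ract_additive[OF CR a] U S(1)])
      show "(\<lambda>x. x \<triangleleft>\<^bsub>C\<^esub> a) ` \<Union>\<F> \<subseteq> ?S"
      proof clarify
        fix x K assume K: "K \<in> \<F>" "x \<in> K"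
        then have "x \<triangleleft>\<^bsub>C\<^esub> a \<in> K"
          using right_module.ract_closed[OF right_stableD(2)[OF \<F>[OF K(1)]] a, of x] by simp
        with upper[OF K(1)] show "x \<triangleleft>\<^bsub>C\<^esub> a \<in> ?S" by blast
      qed
    qed
    with x show ?thesis by blast
  qed
  then have module: "right_module A (sub ?S)"
    using abelian_group_restrict_iff[OF C_group S(2)] S
    by (intro right_module.intro right_module_axioms.intro ring)
      (auto simp: ract_distr ract_distr_scalar ract_assoc ract_one subsetD[OF S(2)])
  note SC = module CL and i = sub_right_linear[OF S(2)]
  note incl = tensor_map_additive[OF SC CR CL i left_linear_id]
  have "comult C ` ?S \<subseteq> incl ` carrier (tensor_prod A (sub ?S) C)"
  proof (rule additive_map_generate_subset[OF C_group left_module_group[OF CCL]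
        left_linear_additive[OF comult_left_linear] U])
    show "subgroup (incl ` carrier (tensor_prod A (sub ?S) C)) (add_monoid CC)"
      by (rule additive_map_image_subgroup[OF abelian_group_tensor_prod[OF SC] left_module_group[OF CCL] incl])
    show "comult C ` \<Union>\<F> \<subseteq> incl ` carrier (tensor_prod A (sub ?S) C)"
    proof clarify
      fix x K assume K: "K \<in> \<F>" "x \<in> K"
      note st = \<F>[OF K(1)]
      obtain t where t: "comult C x = incl t" "t \<in> carrier (tensor_prod A (sub K) C)"
        using st K(2) by (auto simp: right_stable_def)
      have j: "right_linear A (sub K) (sub ?S) (\<lambda>x. x)"
        using upper[OF K(1)] by (auto simp: right_linear_def additive_map_def)
      let ?u = "tensor_map A (sub ?S) C (\<lambda>x. x) (\<lambda>c. c) t"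
      have "incl ?u = incl t"
        by (rule tensor_map_comp[OF right_stableD(2)[OF st] CL SC CR CL j i
              left_linear_id left_linear_id t(2)])
      moreover have "?u \<in> carrier (tensor_prod A (sub ?S) C)"
        by (rule additive_map_closed[OF tensor_map_additive[OF right_stableD(2)[OF st] CL SC j
                left_linear_id] t(2)])
      ultimately show "comult C x \<in> incl ` carrier (tensor_prod A (sub ?S) C)"
        unfolding t(1) by (rule image_eqI[OF sym])
    qed
  qed
  with S(2) module show ?thesis unfolding right_stable_def by (intro conjI)
qed

lemma left_stable_sum_of:
  assumes \<F>: "\<And>K. K \<in> \<F> \<Longrightarrow> left_stable K"
  shows "left_stable (sum_of \<F>)"
proof -
  let ?S = "sum_of \<F>"
  have ring: "ring A" using CL by (simp add: left_module_def)
  have U: "\<Union>\<F> \<subseteq> carrier C" using \<F> by (auto simp: left_stable_def)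
  note S = sum_of_subgroup[OF U] sum_of_carrier[OF U]
  note upper = sum_of_upper[OF U]
  have "a \<triangleright>\<^bsub>C\<^esub> x \<in> ?S" if a: "a \<in> carrier A" and x: "x \<in> ?S" for a x
  proof -
    have "lact C a ` ?S \<subseteq> ?S"
    proof (rule additive_map_generate_subset[OF C_group C_group lact_additive[OF CL a] U S(1)])
      show "lact C a ` \<Union>\<F> \<subseteq> ?S"
      proof clarify
        fix x K assume K: "K \<in> \<F>" "x \<in> K"
        then have "a \<triangleright>\<^bsub>C\<^esub> x \<in> K"
          using left_module.lact_closed[OF left_stableD(2)[OF \<F>[OF K(1)]] a, of x] by simp
        with upper[OF K(1)] show "a \<triangleright>\<^bsub>C\<^esub> x \<in> ?S" by blast
      qed
    qed
    with x show ?thesis by blast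
  qed
  then have module: "left_module A (sub ?S)"
    using abelian_group_restrict_iff[OF C_group S(2)] S
    by (intro left_module.intro left_module_axioms.intro ring)
      (auto simp: lact_distr lact_distr_scalar lact_assoc lact_one subsetD[OF S(2)])
  note CS = CR module and i = sub_left_linear[OF S(2)]
  note incl = tensor_map_additive[OF CS CR CL right_linear_id i]
  have "comult C ` ?S \<subseteq> incl ` carrier (tensor_prod A C (sub ?S))"
  proof (rule additive_map_generate_subset[OF C_group left_module_group[OF CCL]
        left_linear_additive[OF comult_left_linear] U])
    show "subgroup (incl ` carrier (tensor_prod A C (sub ?S))) (add_monoid CC)"
      by (rule additive_map_image_subgroup[OF abelian_group_tensor_prod[OF CS] left_module_group[OF CCL] incl])
    show "comult C ` \<Union>\<F> \<subseteq> incl ` carrier (tensor_prod A C (sub ?S))"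
    proof clarify
      fix x K assume K: "K \<in> \<F>" "x \<in> K"
      note st = \<F>[OF K(1)]
      obtain t where t: "comult C x = incl t" "t \<in> carrier (tensor_prod A C (sub K))"
        using st K(2) by (auto simp: left_stable_def)
      have j: "left_linear A (sub K) (sub ?S) (\<lambda>x. x)"
        using upper[OF K(1)] by (auto simp: left_linear_def additive_map_def)
      let ?u = "tensor_map A C (sub ?S) (\<lambda>c. c) (\<lambda>x. x) t"
      have "incl ?u = incl t"
        by (rule tensor_map_comp[OF CR left_stableD(2)[OF st] CS CR CL right_linear_id
              right_linear_id j i t(2)])
      moreover have "?u \<in> carrier (tensor_prod A C (sub ?S))"
        by (rule additive_map_closed[OF tensor_map_additive[OF CR left_stableD(2)[OF st] CS
                right_linear_id j] t(2)])
      ultimately show "comult C x \<in> incl ` carrier (tensor_prod A C (sub ?S))"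
        unfolding t(1) by (rule image_eqI[OF sym])
    qed
  qed
  with S(2) module show ?thesis unfolding left_stable_def by (intro conjI)
qed

lemma right_coideals_sum_of: "\<F> \<subseteq> right_coideals R A C \<Longrightarrow> sum_of \<F> \<in> right_coideals R A C"
  by (auto simp: right_coideal_iff intro!: right_stable_sum_of)

lemma left_coideals_sum_of: "\<F> \<subseteq> left_coideals R A C \<Longrightarrow> sum_of \<F> \<in> left_coideals R A C"
  by (auto simp: left_coideal_iff intro!: left_stable_sum_of)

end


section \<open>The topology of a fully coprime spectrum\<close>

lemma fully_invariant_generate:
  assumes M: "abelian_group M" and E: "\<And>f. f \<in> E \<Longrightarrow> additive_map M M f"
    and \<F>: "\<And>K. K \<in> \<F> \<Longrightarrow> K \<subseteq> carrier M \<and> fully_invariant E K"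
  shows "fully_invariant E (generate (add_monoid M) (\<Union>\<F>))"
  unfolding fully_invariant_def
proof
  fix f assume f: "f \<in> E"
  have U: "\<Union>\<F> \<subseteq> carrier M" using \<F> by blast
  show "f ` generate (add_monoid M) (\<Union>\<F>) \<subseteq> generate (add_monoid M) (\<Union>\<F>)"
  proof (rule additive_map_generate_subset[OF M M E[OF f] U])
    show "subgroup (generate (add_monoid M) (\<Union>\<F>)) (add_monoid M)"
      using abelian_group.a_group[OF M] U by (intro group.generate_is_subgroup) auto
    show "f ` \<Union>\<F> \<subseteq> generate (add_monoid M) (\<Union>\<F>)"
      using \<F> f by (force simp: fully_invariant_def intro: generate.incl)
  qed
qed

lemma internal_coproduct_subgroup:
  assumes M: "abelian_group M" and E: "\<And>f. f \<in> E \<Longrightarrow> additive_map M M f"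
    and Y: "subgroup Y (add_monoid M)"
  shows "subgroup (internal_coproduct M E X Y) (add_monoid M)"
proof (rule subgroup.intro)
  interpret M: abelian_group M by (rule M)
  have hom: "group_hom (add_monoid M) (add_monoid M) f" if "f \<in> An M E X" for f
    using that additive_map_group_hom[OF M M E] by (auto simp: An_def)
  note homs = group_hom.hom_mult[OF hom, simplified] group_hom.hom_one[OF hom, simplified]
  show "internal_coproduct M E X Y \<subseteq> carrier (add_monoid M)"
    by (auto simp: internal_coproduct_def)
  show "\<one>\<^bsub>add_monoid M\<^esub> \<in> internal_coproduct M E X Y"
  proof -
    have "f \<zero>\<^bsub>M\<^esub> \<in> Y" if "f \<in> An M E X" for f
      unfolding homs(2)[OF that] using subgroup.one_closed[OF Y] by simp
    then show ?thesis by (simp add: internal_coproduct_def)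
  qed
  show "x \<otimes>\<^bsub>add_monoid M\<^esub> y \<in> internal_coproduct M E X Y"
    if "x \<in> internal_coproduct M E X Y" "y \<in> internal_coproduct M E X Y" for x y
  proof -
    have xy: "x \<in> carrier M" "y \<in> carrier M" using that by (simp_all add: internal_coproduct_def)
    have "f (x \<oplus>\<^bsub>M\<^esub> y) \<in> Y" if f: "f \<in> An M E X" for f
      unfolding homs(1)[OF f xy] using subgroup.m_closed[OF Y, of "f x" "f y"] f
        \<open>x \<in> internal_coproduct M E X Y\<close> \<open>y \<in> internal_coproduct M E X Y\<close> by (simp add: internal_coproduct_def)
    with xy show ?thesis by (simp add: internal_coproduct_def)
  qed
  show "inv\<^bsub>add_monoid M\<^esub> x \<in> internal_coproduct M E X Y"
    if "x \<in> internal_coproduct M E X Y" for x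
  proof -
    have "f (inv\<^bsub>add_monoid M\<^esub> x) \<in> Y" if "f \<in> An M E X" for f
      using group_hom.hom_inv[OF hom[OF that], of x] subgroup.m_inv_closed[OF Y, of "f x"] that
        \<open>x \<in> internal_coproduct M E X Y\<close> by (simp add: internal_coproduct_def)
    moreover have "inv\<^bsub>add_monoid M\<^esub> x \<in> carrier M"
      using that M.a_inv_closed[of x] by (simp add: a_inv_def internal_coproduct_def)
    ultimately show ?thesis by (simp add: internal_coproduct_def)
  qed
qed

text \<open>
  One direction is coprimeness.  Conversely, \<open>f \<in> An(X)\<close> sends \<open>K \<subseteq> X\<close> to zero and, \<open>K\<close> being fully
  invariant, sends \<open>K \<subseteq> Y\<close> into \<open>K \<subseteq> Y\<close>.
\<close>

lemma fully_coprime_le_internal_coproduct_iff: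
  assumes K: "fully_coprime M E S K" "K \<subseteq> carrier M"
    and X: "X \<in> S" "fully_invariant E X" and Y: "Y \<in> S" "fully_invariant E Y" "\<zero>\<^bsub>M\<^esub> \<in> Y"
  shows "K \<subseteq> internal_coproduct M E X Y \<longleftrightarrow> K \<subseteq> X \<or> K \<subseteq> Y"
proof
  show "K \<subseteq> X \<or> K \<subseteq> Y" if "K \<subseteq> internal_coproduct M E X Y"
    using K(1) X Y that by (simp add: fully_coprime_def)
  show "K \<subseteq> internal_coproduct M E X Y" if "K \<subseteq> X \<or> K \<subseteq> Y"
    using that
  proof
    assume "K \<subseteq> X"
    then show ?thesis using K(2) Y(3) by (auto simp: internal_coproduct_def An_def)
  next
    assume "K \<subseteq> Y"
    moreover have "f ` K \<subseteq> K" if "f \<in> E" for f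
      using K(1) that by (simp add: fully_coprime_def fully_invariant_def)
    ultimately show ?thesis using K(2) by (fastforce simp: internal_coproduct_def An_def)
  qed
qed

text \<open>
  The index set \<open>\<L>\<close> covers two choices: all subobjects, as for bicoideals, and the fully invariant
  ones, as for one-sided coideals.  Both yield the same open sets, namely those of all additive
  subgroups.
\<close>

proposition is_topological_space_fully_coprime:
  assumes M: "abelian_group M"
    and E: "\<And>f. f \<in> E \<Longrightarrow> additive_map M M f"
    and S: "\<And>K. K \<in> S \<Longrightarrow> subgroup K (add_monoid M)"
    and sums: "\<And>\<F>. \<F> \<subseteq> S \<Longrightarrow> generate (add_monoid M) (\<Union>\<F>) \<in> S"
    and spec: "\<And>K. K \<in> spec \<Longrightarrow> fully_coprime M E S K"
    and \<L>: "\<L> \<subseteq> S" "\<And>L. L \<in> S \<Longrightarrow> fully_invariant E L \<Longrightarrow> L \<in> \<L>"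
  shows "is_topological_space spec {not_below spec L | L. L \<in> \<L>}" (is "is_topological_space _ ?\<tau>")
proof -
  interpret M: abelian_group M by (rule M)
  note group = M.a_group
  have carrier: "K \<subseteq> carrier M" "\<zero>\<^bsub>M\<^esub> \<in> K" if "subgroup K (add_monoid M)" for K
    using subgroup.subset[OF that] subgroup.one_closed[OF that] by simp_all
  have specD: "K \<in> S" "fully_invariant E K" "K \<noteq> {\<zero>\<^bsub>M\<^esub>}" if "K \<in> spec" for K
    using spec[OF that] by (simp_all add: fully_coprime_def)
  \<comment> \<open>The largest fully invariant subobject inside a subgroup \<open>X\<close>.\<close>
  define core where
    "core X = generate (add_monoid M) (\<Union>{K \<in> S. fully_invariant E K \<and> K \<subseteq> X})" for X
  have core_S: "core X \<in> S" for X
    unfolding core_def by (rule sums) blast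
  have core_invariant: "fully_invariant E (core X)" for X
    unfolding core_def
    by (rule fully_invariant_generate[OF M]) (use E carrier S in auto)
  have le_core: "K \<subseteq> core X \<longleftrightarrow> K \<subseteq> X" if X: "subgroup X (add_monoid M)" and K: "K \<in> spec" for X K
  proof
    have "core X \<subseteq> X"
      unfolding core_def by (rule group.generate_subgroup_incl[OF group _ X]) blast
    then show "K \<subseteq> X" if "K \<subseteq> core X" using that by blast
    show "K \<subseteq> core X" if "K \<subseteq> X"
      unfolding core_def using that specD[OF K] by (auto intro: generate.incl)
  qed
  have \<tau>_iff: "U \<in> ?\<tau> \<longleftrightarrow> (\<exists>X. subgroup X (add_monoid M) \<and> U = not_below spec X)" for U
  proof
    show "\<exists>X. subgroup X (add_monoid M) \<and> U = not_below spec X" if "U \<in> ?\<tau>"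
      using that \<L>(1) S by blast
    assume "\<exists>X. subgroup X (add_monoid M) \<and> U = not_below spec X"
    then obtain X where X: "subgroup X (add_monoid M)" "U = not_below spec X" by blast
    have "U = not_below spec (core X)"
      using le_core[OF X(1)] X(2) by (auto simp: not_below_def)
    then show "U \<in> ?\<tau>" using \<L>(2)[OF core_S core_invariant] by blast
  qed
  have inter: "U \<inter> V \<in> ?\<tau>" if UV: "U \<in> ?\<tau>" "V \<in> ?\<tau>" for U V
  proof -
    obtain X where X: "subgroup X (add_monoid M)" "U = not_below spec X"
      using UV(1) unfolding \<tau>_iff by blast
    obtain Y where Y: "subgroup Y (add_monoid M)" "V = not_below spec Y"
      using UV(2) unfolding \<tau>_iff by blast
    let ?Z = "internal_coproduct M E (core X) (core Y)"
    have "K \<subseteq> ?Z \<longleftrightarrow> K \<subseteq> X \<or> K \<subseteq> Y" if K: "K \<in> spec" for K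
      unfolding le_core[OF X(1) K, symmetric] le_core[OF Y(1) K, symmetric]
      by (rule fully_coprime_le_internal_coproduct_iff[OF spec[OF K] carrier(1)[OF S[OF specD(1)[OF K]]]
            core_S core_invariant core_S core_invariant carrier(2)[OF S[OF core_S]]])
    then have "U \<inter> V = not_below spec ?Z"
      using X(2) Y(2) by (auto simp: not_below_def)
    then show ?thesis
      unfolding \<tau>_iff using internal_coproduct_subgroup[OF M E S[OF core_S]] by blast
  qed
  have union: "\<Union>\<U> \<in> ?\<tau>" if \<U>: "\<And>U. U \<in> \<U> \<Longrightarrow> U \<in> ?\<tau>" for \<U>
  proof -
    \<comment> \<open>The carrier is inserted so that the empty family yields the empty open set.\<close>
    let ?X = "\<Inter>(insert (carrier M) {X. subgroup X (add_monoid M) \<and> not_below spec X \<in> \<U>})"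
    have "subgroup ?X (add_monoid M)"
      using group.subgroup_self[OF group] by (intro group.subgroups_Inter[OF group]) auto
    moreover have "\<Union>\<U> = not_below spec ?X"
    proof (intro equalityI subsetI)
      fix K assume "K \<in> \<Union>\<U>"
      then obtain U where U: "U \<in> \<U>" "K \<in> U" by blast
      obtain X where "subgroup X (add_monoid M)" "U = not_below spec X"
        using \<U>[OF U(1)] unfolding \<tau>_iff by blast
      with U show "K \<in> not_below spec ?X" by (auto simp: not_below_def)
    next
      fix K assume K: "K \<in> not_below spec ?X"
      then have "K \<subseteq> carrier M" using carrier(1)[OF S[OF specD(1)]] by (simp add: not_below_def)
      with K obtain X where "not_below spec X \<in> \<U>" "\<not> K \<subseteq> X"
        unfolding not_below_def[of spec ?X] by blast
      moreover have "K \<in> spec" using K unfolding not_below_def[of spec ?X] by blast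
      ultimately show "K \<in> \<Union>\<U>"
        by (intro UnionI[of "not_below spec X"]) (simp_all add: not_below_def)
    qed
    ultimately show ?thesis unfolding \<tau>_iff by blast
  qed
  have whole: "spec \<in> ?\<tau>"
  proof -
    have "\<not> K \<subseteq> {\<zero>\<^bsub>M\<^esub>}" if "K \<in> spec" for K
      using carrier(2)[OF S[OF specD(1)[OF that]]] specD(3)[OF that] by blast
    then have "spec = not_below spec {\<zero>\<^bsub>M\<^esub>}" by (auto simp: not_below_def)
    moreover have "subgroup {\<zero>\<^bsub>M\<^esub>} (add_monoid M)"
      using group.triv_subgroup[OF group] by simp
    ultimately show ?thesis unfolding \<tau>_iff by blast
  qed
  have "istopology (\<lambda>U. U \<in> ?\<tau>)"
    unfolding istopology_def
  proof (intro conjI allI impI)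
    show "U \<inter> V \<in> ?\<tau>" if "U \<in> ?\<tau>" "V \<in> ?\<tau>" for U V
      using that by (rule inter)
    show "\<Union>\<U> \<in> ?\<tau>" if "\<forall>U\<in>\<U>. U \<in> ?\<tau>" for \<U>
      by (rule union) (rule bspec[OF that])
  qed
  then have openin: "openin (topology (\<lambda>U. U \<in> ?\<tau>)) = (\<lambda>U. U \<in> ?\<tau>)"
    by (rule topology_inverse')
  show ?thesis
    unfolding is_topological_space_def
  proof (intro exI conjI)
    show "{U. openin (topology (\<lambda>U. U \<in> ?\<tau>)) U} = ?\<tau>"
      unfolding openin by (rule Collect_mem_eq)
    have topspace_eq: "topspace (topology (\<lambda>U. U \<in> ?\<tau>)) = \<Union>?\<tau>"
      unfolding topspace_def openin by (rule arg_cong[OF Collect_mem_eq])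
    show "topspace (topology (\<lambda>U. U \<in> ?\<tau>)) = spec"
      unfolding topspace_eq
    proof (intro equalityI Union_least Union_upper whole)
      fix U assume "U \<in> ?\<tau>"
      then obtain X where "U = not_below spec X" unfolding \<tau>_iff by blast
      then show "U \<subseteq> spec" by (simp add: not_below_def)
    qed
  qed
qed

theorem theorem4p7:
  fixes R :: "('r, 'q) ring_scheme"
    and A :: "('r, 'a, 'z) module_scheme"
    and C :: "('a, 'c, 'w) coring_scheme"
  assumes "\<one>\<^bsub>R\<^esub> \<noteq> \<zero>\<^bsub>R\<^esub>"
    and "assoc_algebra R A"
    and "coring R A C"
    and "carrier C \<noteq> {\<zero>\<^bsub>C\<^esub>}"
    and "flat_left A C"
    and "flat_right A C"
  shows "is_topological_space (CPSpec R A C) (tau_bi R A C) \<and>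
    is_topological_space (CPSpec_right R A C) (tau_fi_right R A C) \<and>
    is_topological_space (CPSpec_left R A C) (tau_fi_left R A C)"
proof -
  interpret flat_coring R A C
    using assms(3,5,6) by (intro flat_coring.intro flat_coring_axioms.intro)
  have End_right: "additive_map C C f" if "f \<in> End_right A C" for f
    using that right_linear_additive[of A C C f] by (simp add: End_right_def right_colinear_def)
  have End_left: "additive_map C C f" if "f \<in> End_left A C" for f
    using that left_linear_additive[of A C C f] by (simp add: End_left_def left_colinear_def)
  have right_sub: "subgroup K (add_monoid C)" if "K \<in> right_coideals R A C" for K
    using that right_stable_subgroup by (simp add: right_coideal_iff)
  have left_sub: "subgroup K (add_monoid C)" if "K \<in> left_coideals R A C" for K
    using that left_stable_subgroup by (simp add: left_coideal_iff)
  have "is_topological_space (CPSpec R A C) {not_below (CPSpec R A C) L | L. L \<in> bicoideals R A C}"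
    by (rule is_topological_space_fully_coprime[where E = "End_bi A C" and S = "bicoideals R A C", OF C_group])
      (use left_sub End_left left_coideals_sum_of right_coideals_sum_of in
        \<open>auto simp: End_bi_def CPSpec_def bicoideals_eq\<close>)
  moreover have "is_topological_space (CPSpec_right R A C) {not_below (CPSpec_right R A C) L | L.
      L \<in> {L \<in> right_coideals R A C. fully_invariant (End_right A C) L}}"
    by (rule is_topological_space_fully_coprime[where E = "End_right A C" and S = "right_coideals R A C",
          OF C_group End_right right_sub right_coideals_sum_of])
      (auto simp: CPSpec_right_def)
  moreover have "is_topological_space (CPSpec_left R A C) {not_below (CPSpec_left R A C) L | L.
      L \<in> {L \<in> left_coideals R A C. fully_invariant (End_left A C) L}}"
    by (rule is_topological_space_fully_coprime[where E = "End_left A C" and S = "left_coideals R A C",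
          OF C_group End_left left_sub left_coideals_sum_of])
      (auto simp: CPSpec_left_def)
  ultimately show ?thesis
    by (simp add: tau_bi_def tau_fi_right_def tau_fi_left_def)
qed

end
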